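(* Let $\vec F(x,u,t)={}^t(F_1(x,t)-u,F_2(x,t),\dots,F_k(x,t))$ be the deformation described in the context, with bifurcation set $B_{F_1}\subset T=(\mathbb C^\tau,0)$ and matrix $T(t)$ as defined there. The bifurcation set has the expression $$B_{F_1}=\{t\in T:\det T(t)=0\}.$$
   Context: Setting. $X=(\mathbb C^{n+1},0)$ with coordinates $(x,u)$, $S=(\mathbb C^\mu,0)$ with coordinates $s=(u,t)$, $t=(t_1,\dots,t_\tau)\in T=(\mathbb C^\tau,0)$, $\mu=\tau+1$. For $\vec f(x,u)\in(\mathcal O_X)^k$ put $Q_f=(\mathcal O_X)^k/\big(\mathcal O_X\langle\partial\vec f/\partial x_1,\dots,\partial\vec f/\partial x_n\rangle+\vec f^{*}(m_{\mathbb C^k,0})(\mathcal O_X)^k\big)$, assumed to satisfy $0<\mu=\dim_{\mathbb C}Q_f<\infty$. The deformation is $$\vec F(x,s)=\vec f^{(0)}(x)+\sum_{\ell=1}^\tau t_\ell\vec e_\ell(x)+u\vec e_0={}^t(F_1(x,t)-u,F_2(x,t),\dots,F_k(x,t)),$$ a miniversal deformation of $\vec f^{(0)}(x)=\vec f(x,0)=(f_1(x),\dots,f_k(x))$, with $\vec e_0={}^t(-1,0,\dots,0)$, $\vec e_0,\dots,\vec e_\tau$ representing a basis of $Q_f$ and $\vec f(x,u)=\vec F(x,u,0)$. It is assumed that $|s|$ is small enough, and $\tilde X=\{x\in\mathbb C^n:|x|\le\delta\}$ is a closed ball such that all critical points of $F_1(x,t)-u$ on $F_2(x,t)=\dots=F_k(x,t)=0$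 are located inside $\tilde X$. Let $I_{C_0}(t)\subset\mathcal O_{\tilde X\times S}$ be the ideal generated by the $k\times k$ minors of $(\partial\vec F(x,0,t)/\partial x_1,\dots,\partial\vec F(x,0,t)/\partial x_n)$, and $J=\mathcal O_{\tilde X\times S}\langle F_2(x,t),\dots,F_k(x,t)\rangle+I_{C_0}(t)$. Let $\phi_0(x),\dots,\phi_\tau(x)$ be a basis of $\Phi=\mathcal O_{\tilde X}/(\mathcal O_{\tilde X}\langle f_2,\dots,f_k\rangle+I_{C_0}(0))$, which has dimension $\mu$; these also form a free $\mathcal O_S$-basis of $\mathcal O_{\tilde X\times S}/J$. Define $w_{i,j}^\ell(t)$ by $\phi_i(x)\phi_j(x)\equiv\sum_{\ell=0}^\tau w_{i,j}^\ell(t)\phi_\ell(x)$ mod $J$, $W^c(t)=(w_{\ell,b}^c(t))_{0\le\ell,b\le\tau}$, $\zeta_c(t)=\sum_{\ell=0}^\tau w_{c,\ell}^\ell(t)$, and $T(t)=\sum_{c=0}^\tau\zeta_c(t)W^c(t)$. Bifurcation set. $B_{F_1}:=\{t\in T:$ the number of critical points of $F_1(x,t)-u$ on $F_2(x,t)=\dots=F_k(x,t)=0$ is strictly less than $\mu\}\setminus B_M$, where $B_M:=\{t\in T:$ two critical values of $F_1(x,t)-u$ on $F_2(x,t)=\dots=F_k(x,t)=0$ coincide$\}$ is the Maxwell set.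
   Formalization: The Maxwell set B_M is restricted to parameters with μ distinct critical points, two having equal critical value, so removing it takes nothing from B_{F_1}; with B_M as literally defined, the identity fails for f_1 = x^5. *)

theory Defs
  imports "HOL-Analysis.Analysis"
begin

(* Conventions.
   x ranges over complex^'n and the target of the maps is complex^'k, with j1 :: 'k the index of the
   first component.  The index type 'm stands for {0,...,\<tau>}, so \<mu> = CARD('m), and l0 :: 'm is the
   index 0.  A parameter s = (u,t) is a vector s :: complex^'m with u = s $ l0, and T is the
   hyperplane u = 0.  (A separate index type for t_1,...,t_\<tau> would exclude \<tau> = 0.) *)

section \<open>Germs of holomorphic functions\<close>

(* Complex differentiability on a space whose complex scalar multiplication is sc. *)
definition complex_diff_at ::
    "(complex \<Rightarrow> 'a \<Rightarrow> 'a) \<Rightarrow> ('a::real_normed_vector \<Rightarrow> complex) \<Rightarrow> 'a \<Rightarrow> bool" where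
  "complex_diff_at sc f z \<longleftrightarrow>
     (\<exists>D. (f has_derivative D) (at z) \<and> (\<forall>c h. D (sc c h) = c * D h))"

(* Scalar multiplications of C^n x C (coordinates (x,u)) and of C^n x C^\<mu> (coordinates (x,s)). *)
abbreviation scale_xu :: "complex \<Rightarrow> (complex^'n) \<times> complex \<Rightarrow> (complex^'n) \<times> complex" where
  "scale_xu c \<equiv> map_prod ((*s) c) ((*) c)"

abbreviation scale_xs :: "complex \<Rightarrow> (complex^'n) \<times> (complex^'m) \<Rightarrow> (complex^'n) \<times> (complex^'m)" where
  "scale_xs c \<equiv> map_prod ((*s) c) ((*s) c)"

(* Germs along a set K are represented by total functions; only their values near K matter. *)
definition hol_germs ::
    "(complex \<Rightarrow> 'a \<Rightarrow> 'a) \<Rightarrow> 'a set \<Rightarrow> ('a::real_normed_vector \<Rightarrow> complex) set" where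
  "hol_germs sc K = {f. \<forall>z\<in>K. \<forall>\<^sub>F w in nhds z. complex_diff_at sc f w}"

definition hol_vec_germs ::
    "(complex \<Rightarrow> 'a \<Rightarrow> 'a) \<Rightarrow> 'a set \<Rightarrow> ('a::real_normed_vector \<Rightarrow> complex^'k) set" where
  "hol_vec_germs sc K = {g. \<forall>j. (\<lambda>z. g z $ j) \<in> hol_germs sc K}"

definition germ_eq :: "'a::topological_space set \<Rightarrow> ('a \<Rightarrow> 'b) \<Rightarrow> ('a \<Rightarrow> 'b) \<Rightarrow> bool" where
  "germ_eq K f g \<longleftrightarrow> (\<forall>z\<in>K. \<forall>\<^sub>F w in nhds z. f w = g w)"

(* Submodule generated over hol_germs sc K by a finite set G of functions with values in a space
   with scalar multiplication scm; an ideal when scm is the multiplication of complex. *)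
definition germ_span ::
    "(complex \<Rightarrow> 'a \<Rightarrow> 'a) \<Rightarrow> 'a set \<Rightarrow> (complex \<Rightarrow> 'b \<Rightarrow> 'b) \<Rightarrow>
     ('a::real_normed_vector \<Rightarrow> 'b::comm_monoid_add) set \<Rightarrow> ('a \<Rightarrow> 'b) set" where
  "germ_span sc K scm G =
     {h. \<exists>a. (\<forall>g\<in>G. a g \<in> hol_germs sc K) \<and> germ_eq K h (\<lambda>z. \<Sum>g\<in>G. scm (a g z) (g z))}"

(* The classes of the finite family e form a C-basis of M / N. *)
definition basis_mod ::
    "('a \<Rightarrow> 'b) set \<Rightarrow> ('a \<Rightarrow> 'b) set \<Rightarrow> (complex \<Rightarrow> 'b \<Rightarrow> 'b) \<Rightarrow>
     ('m::finite \<Rightarrow> 'a \<Rightarrow> 'b::ab_group_add) \<Rightarrow> bool" where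
  "basis_mod M N scm e \<longleftrightarrow>
     (\<forall>l. e l \<in> M) \<and>
     (\<forall>g\<in>M. \<exists>!c :: 'm \<Rightarrow> complex. (\<lambda>z. g z - (\<Sum>l\<in>UNIV. scm (c l) (e l z))) \<in> N)"

section \<open>The deformation and its critical points\<close>

definition jacobian :: "(complex^'n \<Rightarrow> complex^'k) \<Rightarrow> complex^'n \<Rightarrow> complex^'n^'k" where
  "jacobian g x = (\<chi> j i. deriv (\<lambda>w. g (x + w *s axis i 1) $ j) 0)"

(* The maximal minor of the Jacobian matrix formed by the columns c. *)
definition jac_minor ::
    "('k \<Rightarrow> 'n) \<Rightarrow> (complex^'n \<Rightarrow> complex^'k) \<Rightarrow> complex^'n \<Rightarrow> complex" where
  "jac_minor c g x = det (\<chi> j i. jacobian g x $ j $ c i)"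

definition deformation ::
    "'m \<Rightarrow> (complex^'n \<Rightarrow> complex^'k) \<Rightarrow> ('m::finite \<Rightarrow> complex^'n \<Rightarrow> complex^'k) \<Rightarrow>
     complex^'n \<Rightarrow> complex^'m \<Rightarrow> complex^'k" where
  "deformation l0 f0 e x s =
     f0 x + (\<Sum>l\<in>UNIV - {l0}. s $ l *s e l x) + s $ l0 *s e l0 x"

definition T_space :: "'m \<Rightarrow> (complex^'m) set" where
  "T_space l0 = {t. t $ l0 = 0}"

(* The projection (u,t) \<mapsto> (0,t). *)
definition t_part :: "'m \<Rightarrow> complex^'m \<Rightarrow> complex^'m" where
  "t_part l0 s = (\<chi> l. if l = l0 then 0 else s $ l)"

(* F x t is the value at u = 0, so that F x t $ j1 = F_1(x,t).  Points where F_2 = ... = F_k = 0 is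
   itself singular count as critical; this is the zero set of F_2,...,F_k and the maximal minors. *)
definition critical_points ::
    "(complex^'n) set \<Rightarrow> 'k \<Rightarrow> (complex^'n \<Rightarrow> complex^'m \<Rightarrow> complex^'k) \<Rightarrow>
     complex^'m \<Rightarrow> (complex^'n) set" where
  "critical_points U j1 F t =
     {x\<in>U. (\<forall>j. j \<noteq> j1 \<longrightarrow> F x t $ j = 0) \<and> rank (jacobian (\<lambda>y. F y t) x) < CARD('k)}"

(* Two of the \<mu> critical values coincide: there are \<mu> distinct critical points, two of which have the
   same critical value.  Dropping the first condition (or counting critical values with
   multiplicity) would remove points from the bifurcation set below and make the identity
   "bifurcation set = {det T = 0}" fail; for x^5 + t_3 x^3 + t_2 x^2 + t_1 x it fails at parameters
   with a double critical point and two further critical points of equal value. *)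
definition maxwell_set ::
    "(complex^'n) set \<Rightarrow> 'k \<Rightarrow> 'm \<Rightarrow>
     (complex^'n \<Rightarrow> complex^'m \<Rightarrow> complex^'k) \<Rightarrow> (complex^'m) set" where
  "maxwell_set U j1 l0 F =
     {t \<in> T_space l0.
        finite (critical_points U j1 F t) \<and> card (critical_points U j1 F t) = CARD('m) \<and>
        (\<exists>p\<in>critical_points U j1 F t. \<exists>q\<in>critical_points U j1 F t.
           p \<noteq> q \<and> F p t $ j1 = F q t $ j1)}"

definition bifurcation_set ::
    "(complex^'n) set \<Rightarrow> 'k \<Rightarrow> 'm \<Rightarrow>
     (complex^'n \<Rightarrow> complex^'m \<Rightarrow> complex^'k) \<Rightarrow> (complex^'m) set" where
  "bifurcation_set U j1 l0 F =
     {t \<in> T_space l0.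
        finite (critical_points U j1 F t) \<and> card (critical_points U j1 F t) < CARD('m)}
     - maxwell_set U j1 l0 F"

section \<open>The modules\<close>

(* The submodule defining Q_f, f = f(x,u): since m_{C^k,0} is generated by the coordinates,
   f^*(m_{C^k,0}) is generated by the components of f. *)
definition Qf_submodule ::
    "((complex^'n) \<times> complex \<Rightarrow> complex^'k) \<Rightarrow> ((complex^'n) \<times> complex \<Rightarrow> complex^'k) set" where
  "Qf_submodule f = germ_span scale_xu {(0,0)} (*s)
     (range (\<lambda>i. \<lambda>(x,u). column i (jacobian (\<lambda>y. f (y,u)) x))
      \<union> {\<lambda>z. f z $ j *s axis i 1 | i j. True})"

definition Phi_ideal :: "'k \<Rightarrow> real \<Rightarrow> (complex^'n \<Rightarrow> complex^'k) \<Rightarrow> (complex^'n \<Rightarrow> complex) set" where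
  "Phi_ideal j1 \<delta> f0 = germ_span (*s) (cball 0 \<delta>) (*)
     ({\<lambda>x. f0 x $ j | j. j \<noteq> j1} \<union> {jac_minor c f0 | c. inj c})"

definition J_ideal ::
    "'k \<Rightarrow> 'm \<Rightarrow> real \<Rightarrow> (complex^'n \<Rightarrow> complex^'m \<Rightarrow> complex^'k) \<Rightarrow>
     ((complex^'n) \<times> (complex^'m) \<Rightarrow> complex) set" where
  "J_ideal j1 l0 \<delta> F = germ_span scale_xs (cball 0 \<delta> \<times> {0}) (*)
     ({\<lambda>(x,s). F x (t_part l0 s) $ j | j. j \<noteq> j1}
      \<union> {\<lambda>(x,s). jac_minor c (\<lambda>y. F y (t_part l0 s)) x | c. inj c})"

(* The classes of \<phi> form a basis of the O_S-module O_{X~ x S} / J. *)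
definition free_basis_mod ::
    "real \<Rightarrow> ((complex^'n) \<times> (complex^'m) \<Rightarrow> complex) set \<Rightarrow>
     ('m \<Rightarrow> complex^'n \<Rightarrow> complex) \<Rightarrow> bool" where
  "free_basis_mod \<delta> J \<phi> \<longleftrightarrow>
     (\<forall>h \<in> hol_germs scale_xs (cball 0 \<delta> \<times> {0}).
        \<exists>a. (\<forall>l. a l \<in> hol_germs (*s) {0}) \<and>
            (\<lambda>(x,s). h (x,s) - (\<Sum>l\<in>UNIV. a l s * \<phi> l x)) \<in> J) \<and>
     (\<forall>a. (\<forall>l. a l \<in> hol_germs (*s) {0}) \<and> (\<lambda>(x,s). \<Sum>l\<in>UNIV. a l s * \<phi> l x) \<in> J \<longrightarrow>
        (\<forall>l. germ_eq {0} (a l) (\<lambda>_. 0)))"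

section \<open>The matrix T(t)\<close>

(* w i j l t is w_{i,j}^l(t). *)
definition W_mat ::
    "('m \<Rightarrow> 'm \<Rightarrow> 'm \<Rightarrow> complex^'m \<Rightarrow> complex) \<Rightarrow> 'm \<Rightarrow> complex^'m \<Rightarrow> complex^'m^'m" where
  "W_mat w c t = (\<chi> l b. w l b c t)"

definition zeta ::
    "('m \<Rightarrow> 'm \<Rightarrow> 'm \<Rightarrow> complex^'m \<Rightarrow> complex) \<Rightarrow> 'm::finite \<Rightarrow> complex^'m \<Rightarrow> complex" where
  "zeta w c t = (\<Sum>l\<in>UNIV. w c l l t)"

definition T_mat ::
    "('m \<Rightarrow> 'm \<Rightarrow> 'm \<Rightarrow> complex^'m \<Rightarrow> complex) \<Rightarrow> complex^'m \<Rightarrow> complex^'m^'m" where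
  "T_mat w t = (\<Sum>c\<in>UNIV. \<chi> l b. zeta w c t * W_mat w c t $ l $ b)"

end

theory Submission
  imports
    Defs
    "HOL-Computational_Algebra.Fundamental_Theorem_Algebra"
    "HOL-Complex_Analysis.Cauchy_Integral_Formula"
begin

text \<open>
  For fixed \<open>t\<close> the structure constants \<open>w i j l t\<close> define an algebra on \<open>\<complex>\<^sup>\<mu>\<close>, the fibre at \<open>t\<close> of the finite
  free \<open>\<O>\<^sub>S\<close>-algebra \<open>\<O>/J\<close>, and \<open>T(t)\<close> is the Gram matrix of its trace form: \<open>\<zeta>\<^sub>c\<close> is the trace of
  multiplication by \<open>\<phi>\<^sub>c\<close>, so the entry at \<open>(l, b)\<close> is the trace of multiplication by \<open>\<phi>\<^sub>l \<phi>\<^sub>b\<close>.  The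
  classical discriminant criterion says that the trace form of a commutative algebra of dimension
  \<open>\<mu>\<close> over \<open>\<complex>\<close> is nondegenerate iff the algebra has \<open>\<mu>\<close> different characters
  (\<open>trace_form_nondegenerate_if_split\<close>, \<open>split_if_trace_form_nondegenerate\<close>); it never has more.
  Since a parameter of the Maxwell set has \<open>\<mu>\<close> critical points, the bifurcation set consists of the
  \<open>t\<close> with fewer than \<open>\<mu>\<close> critical points.  So it suffices that, for \<open>t\<close> near 0, the critical points
  correspond bijectively to the characters of the fibre at \<open>t\<close>.

  A critical point \<open>p\<close> is a common zero of the generators of \<open>J\<close>, hence evaluation at \<open>p\<close> gives the
  character \<open>(\<phi>\<^sub>l(p))\<^sub>l\<close>; it determines \<open>p\<close>, because modulo \<open>J\<close> the coordinates \<open>x\<^sub>i\<close> are combinations of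
  the \<open>\<phi>\<^sub>l\<close>.  The converse is harder, since \<open>t\<close> is an actual point while \<open>J\<close> consists of germs: a
  germ represented near \<open>t = 0\<close> can be evaluated at \<open>t\<close> only if \<open>t\<close> is small enough for that germ,
  so only finitely many germs can be used.

  Let \<open>\<psi>\<close> be a character of the fibre at \<open>t\<close>, let \<open>p\<close> be the point whose coordinates are the values
  of \<open>\<psi>\<close> at the \<open>x\<^sub>i\<close>, and put \<open>D(h) = \<psi>(h) - h(p, t)\<close>.  Characters of nearby fibres stay bounded, so
  by compactness it is enough to treat \<open>(\<psi>, t)\<close> near \<open>(\<theta>, 0)\<close> with \<open>\<theta>\<close> a character of the fibre at
  0.  Then \<open>p\<close> is near the point \<open>q\<close> of \<open>\<theta>\<close>, and \<open>q\<close> lies in the closed ball, as otherwise the affine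
  function \<open>\<Sum>\<^sub>i cnj q\<^sub>i x\<^sub>i - \<bar>q\<bar>\<^sup>2\<close> would be a unit killed by \<open>\<theta>\<close>
  (\<open>character_point_in_cball\<close>).
  Hadamard's lemma \<open>h = h(q, s) + \<Sum>\<^sub>i (x\<^sub>i - q\<^sub>i) h\<^sub>i\<close> gives \<open>D(h) = \<Sum>\<^sub>i (p\<^sub>i - q\<^sub>i) D(h\<^sub>i)\<close>, and expanding
  the \<open>h\<^sub>i\<close> in the \<open>\<phi>\<^sub>l\<close> and the generators \<open>g\<close> of \<open>J\<close> bounds \<open>D(h)\<close> by a small multiple of the sum of
  all \<open>\<bar>D(\<phi>\<^sub>l)\<bar>\<close> and \<open>\<bar>D(g)\<bar>\<close> (\<open>discrepancy_le_defect\<close>).  Applied to the finitely many \<open>h = \<phi>\<^sub>l\<close> and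
  \<open>h = g\<close>, this says that the sum is at most a small multiple of itself, as in Nakayama's lemma, so
  it is 0 (\<open>eventually_defect_0\<close>).  Thus \<open>p\<close> is a zero of all \<open>g\<close> and \<open>\<psi>\<close> is the evaluation at \<open>p\<close>.

  Hadamard's lemma needs partial derivatives of holomorphic functions of several variables to be
  holomorphic again.  This comes from Cauchy's formula in one direction and differentiation under
  the integral sign.
\<close>

section \<open>Eigenvalues, traces and maximal minors\<close>

lemma poly_det:
  fixes M :: "'a::comm_ring_1 poly^'m^'m"
  shows "poly (det M) z = det (\<chi> i j. poly (M $ i $ j) z)"
  by (simp add: det_def poly_sum poly_mult poly_prod of_int_poly)

lemma coeff_1_prod_linear:
  fixes a :: "'i \<Rightarrow> 'a::comm_ring_1"
  assumes "finite I"
  shows "coeff (\<Prod>i\<in>I. [:1, a i:]) 0 = 1 \<and> coeff (\<Prod>i\<in>I. [:1, a i:]) 1 = (\<Sum>i\<in>I. a i)"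
  using assms by (induction I rule: finite_induct) (auto simp: coeff_mult)

text \<open>
  The matrix is \<open>1 + X A\<close>.  A permutation other than the identity moves at least two indices, so its
  term in the Leibniz formula is divisible by \<open>X\<^sup>2\<close>.
\<close>
lemma coeff_1_det_eq_trace:
  fixes A :: "'a::comm_ring_1^'m^'m"
  shows "coeff (det (\<chi> i j. [:if i = j then 1 else 0, A $ i $ j:])) 1 = trace A"
proof -
  let ?M = "\<lambda>i j. [:if i = j then 1 else 0, A $ i $ j:]"
  have off: "coeff (\<Prod>i\<in>UNIV. ?M i (p i)) 1 = 0" if p: "p permutes (UNIV :: 'm set)" "p \<noteq> id" for p
  proof -
    obtain i where i: "p i \<noteq> i" using p(2) by (metis eq_id_iff)
    have j: "p (p i) \<noteq> p i" using permutes_inj[OF p(1)] i by (auto dest: injD)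
    have "(\<Prod>i\<in>UNIV. ?M i (p i)) = ?M i (p i) * (?M (p i) (p (p i)) * (\<Prod>i\<in>UNIV - {i} - {p i}. ?M i (p i)))"
      using i by (subst prod.remove[of _ i], simp, simp, subst prod.remove[of _ "p i"]) auto
    also have "coeff \<dots> 1 = 0"
      using i j by (simp add: coeff_mult)
    finally show ?thesis .
  qed
  have "coeff (det (\<chi> i j. ?M i j)) 1 =
        (\<Sum>p\<in>{p. p permutes (UNIV :: 'm set)}. coeff (of_int (sign p) * (\<Prod>i\<in>UNIV. ?M i (p i))) 1)"
    by (simp add: det_def coeff_sum)
  also have "\<dots> = (\<Sum>p\<in>{p. p permutes (UNIV :: 'm set)}. if p = id then trace A else 0)"
  proof (rule sum.cong[OF refl])
    fix p assume p: "p \<in> {p. p permutes (UNIV :: 'm set)}"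
    show "coeff (of_int (sign p) * (\<Prod>i\<in>UNIV. ?M i (p i))) 1 = (if p = id then trace A else 0)"
    proof (cases "p = id")
      case True
      then show ?thesis
        using coeff_1_prod_linear[of UNIV "\<lambda>i. A $ i $ i"] by (simp add: sign_id trace_def)
    next
      case False
      then show ?thesis using off[of p] p by (simp add: of_int_poly)
    qed
  qed
  also have "\<dots> = trace A"
    by (simp add: permutes_id)
  finally show ?thesis .
qed

text \<open>
  Lets a small set of vectors be the set of rows of a square matrix, repetitions allowed.
\<close>
lemma obtain_enumeration:
  assumes "finite X" "X \<noteq> {}" "card X \<le> CARD('m::finite)"
  obtains r :: "'m::finite \<Rightarrow> 'a" where "range r = X"
proof -
  obtain g :: "'a \<Rightarrow> 'm" where g: "inj_on g X"
    using card_le_inj[of X "UNIV :: 'm set"] assms by auto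
  obtain x0 where "x0 \<in> X" using assms by auto
  let ?r = "\<lambda>p. if p \<in> g ` X then inv_into X g p else x0"
  have "range ?r = X"
  proof
    show "range ?r \<subseteq> X" using \<open>x0 \<in> X\<close> by (auto simp: g)
    show "X \<subseteq> range ?r"
    proof
      fix x assume "x \<in> X"
      then have "x = ?r (g x)" using g by simp
      then show "x \<in> range ?r" by (rule range_eqI)
    qed
  qed
  then show ?thesis by (rule that)
qed

lemma det_eq_0_obtain_kernel:
  fixes A :: "'a::field^'m^'m"
  assumes "det A = 0"
  obtains v where "v \<noteq> 0" "A *v v = 0"
proof -
  have "\<not> invertible A" using assms by (simp add: invertible_det_nz)
  then have "\<nexists>B. B ** A = mat 1" by (simp add: invertible_left_inverse)
  then show ?thesis using that by (auto simp: matrix_left_invertible_ker)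
qed

text \<open>
  A zero \<open>z\<close> of the polynomial \<open>det (1 + X A)\<close> would make \<open>- 1 / z\<close> an eigenvalue of \<open>A\<close>.  So this
  polynomial has no zeros, hence is constant, and its linear coefficient \<open>trace A\<close> vanishes.
\<close>
lemma trace_eq_0_if_only_eigenvalue_0:
  fixes A :: "complex^'m^'m"
  assumes only: "\<And>z v. v \<noteq> 0 \<Longrightarrow> A *v v = z *s v \<Longrightarrow> z = 0"
  shows "trace A = 0"
proof -
  define P where "P = det (\<chi> i j. [:if i = j then 1 else 0, A $ i $ j:])"
  have "poly P z \<noteq> 0" for z
  proof
    assume "poly P z = 0"
    moreover have "poly P z = det (mat 1 + (\<chi> i j. z * A $ i $ j))" for z
      unfolding P_def poly_det by (rule arg_cong[of _ _ det]) (simp add: vec_eq_iff mat_def)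
    ultimately obtain v where v: "v \<noteq> 0" "(mat 1 + (\<chi> i j. z * A $ i $ j)) *v v = 0"
      using det_eq_0_obtain_kernel by metis
    have "(mat 1 + (\<chi> i j. z * A $ i $ j)) *v v = v + z *s (A *v v)"
      by (simp add: matrix_vector_mult_add_rdistrib)
        (simp add: vec_eq_iff matrix_vector_mult_def sum_distrib_left mult.assoc)
    then have eq: "v + z *s (A *v v) = 0" using v by simp
    then have "z \<noteq> 0" using v by auto
    then have "A *v v = (- 1 / z) *s v"
      using eq by (simp add: vec_eq_iff add_eq_0_iff field_simps)
    then show False using only[OF v(1)] \<open>z \<noteq> 0\<close> by fastforce
  qed
  then have "degree P = 0"
    using Fundamental_Theorem_Algebra.fundamental_theorem_of_algebra[of P] by (auto simp: constant_degree)
  then have "coeff P 1 = 0" by (simp add: coeff_eq_0)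
  then show ?thesis using coeff_1_det_eq_trace[of A] by (simp add: P_def)
qed

text \<open>
  The vector \<open>p(A) v\<close>, computed by Horner's scheme.
\<close>
definition krylov :: "'a::field^'m^'m \<Rightarrow> 'a^'m \<Rightarrow> 'a poly \<Rightarrow> 'a^'m" where
  "krylov A v p = fold_coeffs (\<lambda>c y. c *s v + A *v y) p 0"

lemma krylov_0 [simp]: "krylov A v 0 = 0"
  by (simp add: krylov_def)

lemma krylov_pCons [simp]: "krylov A v (pCons c p) = c *s v + A *v krylov A v p"
  by (cases "p = 0 \<and> c = 0") (auto simp: krylov_def)

lemma krylov_add: "krylov A v (p + q) = krylov A v p + krylov A v q"
  by (induction p q rule: poly_induct2) (simp_all add: matrix_vector_right_distrib vector_sadd_rdistrib)

lemma krylov_smult: "krylov A v (smult c p) = c *s krylov A v p"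
  by (induction p) (simp_all add: vector_add_ldistrib vec.scale)

lemma krylov_sum: "krylov A v (\<Sum>i\<in>I. p i) = (\<Sum>i\<in>I. krylov A v (p i))"
  by (induction I rule: infinite_finite_induct) (simp_all add: krylov_add)

text \<open>
  The vectors \<open>v, A v, A\<^sup>2 v, \<dots>\<close> cannot all be independent.
\<close>
lemma krylov_annihilator:
  fixes A :: "'a::field^'m^'m"
  obtains p where "p \<noteq> 0" "krylov A v p = 0"
proof -
  let ?u = "\<lambda>i. krylov A v (monom 1 i)"
  show ?thesis
  proof (cases "inj_on ?u {..CARD('m)}")
    case False
    then obtain i j where ij: "i \<noteq> j" "?u i = ?u j" by (auto simp: inj_on_def)
    have "krylov A v (monom 1 i - monom 1 j) = 0"
      using krylov_add[of A v "monom 1 i - monom 1 j" "monom 1 j"] ij by simp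
    moreover have "monom 1 i - monom 1 j \<noteq> (0 :: 'a poly)"
      using ij by (simp add: monom_eq_iff')
    ultimately show ?thesis using that by blast
  next
    case True
    have "vec.dependent (?u ` {..CARD('m)})"
    proof (rule ccontr)
      assume "vec.independent (?u ` {..CARD('m)})"
      from vec.independent_card_le_dim[OF subset_UNIV this] show False
        by (simp add: card_image[OF True] card_cart_basis)
    qed
    then obtain c i where c: "(\<Sum>x\<in>?u ` {..CARD('m)}. c x *s x) = 0" and i: "i \<le> CARD('m)" "c (?u i) \<noteq> 0"
      by (auto simp: vec.dependent_finite)
    define p where "p = (\<Sum>i\<le>CARD('m). smult (c (?u i)) (monom 1 i))"
    have "krylov A v p = 0"
      using c by (simp add: p_def krylov_sum krylov_smult sum.reindex[OF True] del: smult_monom)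
    moreover have "coeff p i = c (?u i)"
      using i(1) by (simp add: p_def coeff_sum if_distrib sum.delta cong: if_cong)
    then have "p \<noteq> 0" using i(2) by (metis coeff_0)
    ultimately show ?thesis using that by blast
  qed
qed

text \<open>
  Take \<open>p \<noteq> 0\<close> of least degree with \<open>p(A) v = 0\<close> and split off a linear factor, \<open>p = (X - z) q\<close>.  Then
  \<open>q(A) v\<close> is nonzero by minimality and is an eigenvector for \<open>z\<close>.  It lies in every invariant
  subspace that contains \<open>v\<close>.
\<close>
lemma eigenvector_in_invariant_subspace:
  fixes A :: "complex^'m^'m"
  assumes V: "vec.subspace V" and v: "v \<in> V" "v \<noteq> 0"
    and inv: "\<And>x. x \<in> V \<Longrightarrow> A *v x \<in> V"
  obtains x z where "x \<in> V" "x \<noteq> 0" "A *v x = z *s x"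
proof -
  have krylov_in: "krylov A v p \<in> V" for p
    by (induction p) (auto intro!: vec.subspace_add[OF V] vec.subspace_scale[OF V] inv v vec.subspace_0[OF V])
  obtain p where p: "p \<noteq> 0" "krylov A v p = 0"
    and least: "\<And>q. q \<noteq> 0 \<Longrightarrow> krylov A v q = 0 \<Longrightarrow> degree p \<le> degree q"
    using ex_has_least_nat[of "\<lambda>p. p \<noteq> 0 \<and> krylov A v p = 0" _ degree] krylov_annihilator by metis
  have "degree p \<noteq> 0"
  proof
    assume "degree p = 0"
    then obtain c where "p = [:c:]" by (rule degree_eq_zeroE)
    with p v show False by simp
  qed
  then obtain z where "poly p z = 0"
    using Fundamental_Theorem_Algebra.fundamental_theorem_of_algebra[of p] by (auto simp: constant_degree)
  then obtain q where q: "p = [:- z, 1:] * q" by (metis dvdE poly_eq_0_iff_dvd)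
  have "q \<noteq> 0" using p q by auto
  then have "degree p = Suc (degree q)" unfolding q by (subst degree_mult_eq) auto
  then have nz: "krylov A v q \<noteq> 0" using least[OF \<open>q \<noteq> 0\<close>] by auto
  have "p = smult (- z) q + pCons 0 q" by (simp add: q)
  then have "krylov A v p = (- z) *s krylov A v q + A *v krylov A v q"
    by (simp only: krylov_add krylov_smult krylov_pCons) simp
  then have "A *v krylov A v q = z *s krylov A v q"
    using p by (simp add: add_eq_0_iff vector_smult_lneg)
  then show ?thesis using that krylov_in nz by blast
qed

text \<open>
  An eigenspace of one matrix is invariant under every matrix commuting with it, so the matrices can
  be treated one after the other inside shrinking subspaces.
\<close>
lemma common_eigenvector:
  fixes L :: "'i \<Rightarrow> complex^'m^'m"
  assumes "finite I" and comm: "\<And>a b x. a \<in> I \<Longrightarrow> b \<in> I \<Longrightarrow> L a *v (L b *v x) = L b *v (L a *v x)"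
    and "vec.subspace V" "v \<in> V" "v \<noteq> 0"
    and "\<And>a x. a \<in> I \<Longrightarrow> x \<in> V \<Longrightarrow> L a *v x \<in> V"
  shows "\<exists>x\<in>V. x \<noteq> 0 \<and> (\<forall>a\<in>I. \<exists>z. L a *v x = z *s x)"
  using assms
proof (induction I arbitrary: V v rule: finite_induct)
  case empty
  then show ?case by auto
next
  case (insert a I)
  obtain y z where y: "y \<in> V" "y \<noteq> 0" "L a *v y = z *s y"
    using eigenvector_in_invariant_subspace[OF insert.prems(2-4), of "L a"] insert.prems(5) by auto
  define E where "E = {x\<in>V. L a *v x = z *s x}"
  have E: "vec.subspace E"
    using insert.prems(2) unfolding E_def vec.subspace_def
    by (auto simp: matrix_vector_right_distrib vec.scale vector_add_ldistrib vec_eq_iff algebra_simps)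
  have inv: "L b *v x \<in> E" if "b \<in> I" "x \<in> E" for b x
    using that insert.prems(1)[of a b x] insert.prems(5)[of b x] by (auto simp: E_def vec.scale)
  have "\<exists>x\<in>E. x \<noteq> 0 \<and> (\<forall>a\<in>I. \<exists>z. L a *v x = z *s x)"
    by (rule insert.IH[where v = y]) (use insert.prems(1) E y inv in \<open>auto simp: E_def\<close>)
  then show ?case by (auto simp: E_def)
qed

text \<open>
  One-sided invertibility of a matrix concerns the indexed family of its rows or columns, where a
  repetition counts as a relation; the rank concerns the set of them.
\<close>
lemma independent_family_iff:
  fixes v :: "'k::finite \<Rightarrow> 'a::field^'n::finite"
  shows "(\<forall>c. (\<Sum>i\<in>UNIV. c i *s v i) = 0 \<longrightarrow> (\<forall>i. c i = 0)) \<longleftrightarrow> inj v \<and> vec.independent (range v)"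
    (is "?L \<longleftrightarrow> ?R")
proof
  assume L: ?L
  have inj: "inj v"
  proof (rule injI, rule ccontr)
    fix i j assume ij: "v i = v j" "i \<noteq> j"
    let ?c = "\<lambda>l. (if l = i then 1 else 0) - (if l = j then 1 else 0 :: 'a)"
    have "(\<Sum>l\<in>UNIV. ?c l *s v l) =
        (\<Sum>l\<in>UNIV. (if l = i then v l else 0) - (if l = j then v l else 0))"
      by (rule sum.cong) auto
    then have "(\<Sum>l\<in>UNIV. ?c l *s v l) = v i - v j" by (simp add: sum_subtractf)
    then have "?c i = 0" using ij by (intro L[rule_format, of ?c i]) simp
    then show False using ij by simp
  qed
  have "vec.independent (range v)"
    unfolding vec.dependent_finite[OF finite_imageI[OF finite_class.finite_UNIV]]
  proof clarify
    fix u i assume "(\<Sum>x\<in>range v. u x *s x) = 0" "u (v i) \<noteq> 0"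
    then show False using L[rule_format, of "\<lambda>i. u (v i)" i] by (simp add: sum.reindex[OF inj])
  qed
  with inj show ?R by simp
next
  assume R: ?R
  show ?L
  proof (intro allI impI)
    fix c i assume c: "(\<Sum>i\<in>UNIV. c i *s v i) = 0"
    have "(\<Sum>x\<in>range v. c (inv v x) *s x) = 0"
      using R c by (simp add: sum.reindex)
    then have "c (inv v (v i)) = 0"
      using R vec.independentD[of "range v" "range v" "\<lambda>x. c (inv v x)" "v i"] by auto
    then show "c i = 0" using R by simp
  qed
qed

lemma right_invertible_iff_full_rank:
  fixes A :: "'a::field^'n^'k"
  shows "(\<exists>B::'a^'k^'n. A ** B = mat 1) \<longleftrightarrow> rank A = CARD('k)"
proof -
  have rows: "rows A = range (\<lambda>i. row i A)" by (auto simp: rows_def)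
  have "inj (\<lambda>i. row i A) \<and> vec.independent (rows A) \<longleftrightarrow> vec.dim (rows A) = CARD('k)"
  proof
    assume "inj (\<lambda>i. row i A) \<and> vec.independent (rows A)"
    then show "vec.dim (rows A) = CARD('k)"
      by (simp add: vec.dim_eq_card_independent rows card_image)
  next
    assume dim: "vec.dim (rows A) = CARD('k)"
    have fin: "finite (rows A)" by (simp add: rows)
    have "card (rows A) \<le> CARD('k)" unfolding rows by (rule card_image_le) simp
    then have card: "card (rows A) = CARD('k)"
      using vec.dim_le_card'[OF fin] dim by simp
    then have "inj (\<lambda>i. row i A)" by (simp add: rows eq_card_imp_inj_on)
    moreover have "vec.independent (rows A)"
      by (rule vec.card_le_dim_spanning[of _ "rows A"])
        (use fin card dim vec.span_superset in auto)
    ultimately show "inj (\<lambda>i. row i A) \<and> vec.independent (rows A)" by simp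
  qed
  then show ?thesis
    unfolding matrix_right_invertible_independent_rows independent_family_iff rows row_rank_def_gen .
qed

text \<open>
  If the rank is maximal, the columns span, and a basis chosen among them gives a nonzero minor.
  Conversely, a linear relation between the rows restricts to every maximal submatrix.
\<close>
lemma rank_less_iff_maximal_minors_vanish:
  fixes A :: "'a::field^'n^'k"
  shows "rank A < CARD('k) \<longleftrightarrow> (\<forall>c. inj c \<longrightarrow> det (\<chi> j i. A $ j $ c i) = 0)"
proof -
  have le: "rank A \<le> CARD('k)"
  proof -
    have rows: "rows A = range (\<lambda>i. row i A)" by (auto simp: rows_def)
    have "vec.dim (rows A) \<le> card (rows A)" by (rule vec.dim_le_card') (simp add: rows)
    also have "\<dots> \<le> CARD('k)" unfolding rows by (rule card_image_le) simp
    finally show ?thesis by (simp add: row_rank_def_gen)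
  qed
  have "rank A = CARD('k) \<longleftrightarrow> (\<exists>c. inj c \<and> det (\<chi> j i. A $ j $ c i) \<noteq> 0)"
  proof
    assume "rank A = CARD('k)"
    then have span: "vec.span (columns A) = UNIV"
      by (simp add: right_invertible_iff_full_rank[symmetric] matrix_right_invertible_span_columns)
    obtain B where B: "B \<subseteq> columns A" "vec.independent B" "columns A \<subseteq> vec.span B"
      using vec.maximal_independent_subset by blast
    have "vec.span B = UNIV" using B(3) span by (metis top.extremum_uniqueI vec.span_mono vec.span_span)
    then have "card B = vec.dim (UNIV :: ('a^'k) set)"
      using B(2) by (metis vec.dim_span_eq_card_independent)
    then have "card B = CARD('k)" by (simp add: vec.dim_UNIV card_cart_basis)
    moreover have "finite B" using B(2) by (rule vec.finiteI_independent)
    ultimately obtain r where r: "bij_betw r (UNIV :: 'k set) B"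
      using finite_same_card_bij[OF finite_class.finite_UNIV] by metis
    have "\<forall>i. \<exists>l. column l A = r i"
    proof
      fix i
      have "r i \<in> columns A" using B(1) bij_betwE[OF r] by (rule_tac subsetD) auto
      then show "\<exists>l. column l A = r i" by (auto simp: columns_def)
    qed
    then obtain c where c: "\<And>i. column (c i) A = r i" by metis
    have "inj c"
      using c r by (metis bij_betw_def injI inj_eq)
    define M where "M = (\<chi> j i. A $ j $ c i)"
    have col: "column i M = r i" for i
      using c[of i] by (simp add: M_def column_def)
    have "inj (\<lambda>i. column i M) \<and> vec.independent (range (\<lambda>i. column i M))"
      using r B(2) by (simp add: col bij_betw_def)
    then have "\<exists>B. B ** M = mat 1"
      unfolding matrix_left_invertible_independent_columns independent_family_iff .
    then have "det M \<noteq> 0"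
      by (simp add: invertible_left_inverse[symmetric] invertible_det_nz)
    then show "\<exists>c. inj c \<and> det (\<chi> j i. A $ j $ c i) \<noteq> 0"
      using \<open>inj c\<close> by (auto simp: M_def)
  next
    assume "\<exists>c. inj c \<and> det (\<chi> j i. A $ j $ c i) \<noteq> 0"
    then obtain c where "det (\<chi> j i. A $ j $ c i) \<noteq> 0" by blast
    then have "\<exists>B. (\<chi> j i. A $ j $ c i) ** B = mat 1"
      by (simp add: invertible_right_inverse[symmetric] invertible_det_nz)
    then have ind: "\<And>a j. (\<Sum>j\<in>UNIV. a j *s row j (\<chi> j i. A $ j $ c i)) = 0 \<Longrightarrow> a j = 0"
      unfolding matrix_right_invertible_independent_rows by blast
    have "\<exists>B::'a^'k^'n. A ** B = mat 1"
      unfolding matrix_right_invertible_independent_rows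
    proof (intro allI impI)
      fix a j assume "(\<Sum>j\<in>UNIV. a j *s row j A) = 0"
      then have "(\<Sum>j\<in>UNIV. a j * A $ j $ l) = 0" for l
        by (simp add: vec_eq_iff row_def)
      then show "a j = 0" by (intro ind) (simp add: vec_eq_iff row_def)
    qed
    then show "rank A = CARD('k)" by (simp add: right_invertible_iff_full_rank)
  qed
  then show ?thesis using le by auto
qed

section \<open>Characters of a finite-dimensional commutative algebra\<close>

text \<open>
  A unital algebra homomorphism to \<open>\<complex>\<close>, given by its values on the basis whose structure constants are
  \<open>w\<close>.  In a unital algebra a multiplicative functional preserves 1 as soon as it is nonzero.
\<close>
definition algebra_character :: "('m \<Rightarrow> 'm \<Rightarrow> 'm \<Rightarrow> complex) \<Rightarrow> complex^'m::finite \<Rightarrow> bool" where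
  "algebra_character w \<psi> \<longleftrightarrow>
     \<psi> \<noteq> 0 \<and> (\<forall>i j. \<psi> $ i * \<psi> $ j = (\<Sum>l\<in>UNIV. w i j l * \<psi> $ l))"

text \<open>
  Dedekind's argument.  If \<open>\<theta> = \<Sum> c\<^sub>\<psi> \<psi>\<close>, comparing the value of \<open>\<theta>\<close> at the product of two basis
  elements \<open>i\<close> and \<open>j\<close> with \<open>\<theta>\<^sub>i\<close> times its value at \<open>j\<close> gives \<open>\<Sum> c\<^sub>\<psi> (\<psi>\<^sub>i - \<theta>\<^sub>i) \<psi> = 0\<close>.  By
  induction the \<open>\<psi>\<close> are independent, so all \<open>c\<^sub>\<psi>\<close> and hence \<open>\<theta>\<close> vanish.
\<close>
lemma independent_algebra_characters_finite:
  assumes "finite X" "\<forall>\<psi>\<in>X. algebra_character w \<psi>"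
  shows "vec.independent X"
  using assms
proof (induction X rule: finite_induct)
  case empty
  then show ?case by (simp add: vec.independent_empty)
next
  case (insert \<theta> X)
  then have ind: "vec.independent X" by auto
  have "\<theta> \<notin> vec.span X"
  proof
    assume "\<theta> \<in> vec.span X"
    then obtain c where c: "\<theta> = (\<Sum>\<psi>\<in>X. c \<psi> *s \<psi>)"
      using vec.span_finite[OF insert.hyps(1)] by auto
    then have cl: "\<theta> $ l = (\<Sum>\<psi>\<in>X. c \<psi> * \<psi> $ l)" for l by simp
    have "(\<Sum>\<psi>\<in>X. (c \<psi> * (\<psi> $ i - \<theta> $ i)) *s \<psi>) = 0" for i
    proof -
      have "(\<Sum>\<psi>\<in>X. c \<psi> * (\<psi> $ i - \<theta> $ i) * \<psi> $ j) = 0" for j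
      proof -
        have "(\<Sum>\<psi>\<in>X. c \<psi> * (\<psi> $ i * \<psi> $ j)) = (\<Sum>\<psi>\<in>X. c \<psi> * (\<Sum>l\<in>UNIV. w i j l * \<psi> $ l))"
          using insert.prems by (intro sum.cong) (auto simp: algebra_character_def)
        also have "\<dots> = (\<Sum>l\<in>UNIV. w i j l * \<theta> $ l)"
          by (simp add: cl sum_distrib_left mult.left_commute sum.swap[of _ X])
        also have "\<dots> = \<theta> $ i * \<theta> $ j"
          using insert.prems by (auto simp: algebra_character_def)
        also have "\<dots> = (\<Sum>\<psi>\<in>X. c \<psi> * (\<theta> $ i * \<psi> $ j))"
          by (simp add: cl[of j] sum_distrib_left mult.left_commute)
        finally show ?thesis
          by (simp add: algebra_simps sum_subtractf)
      qed
      then show ?thesis by (simp add: vec_eq_iff)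
    qed
    then have zero: "c \<psi> * (\<psi> $ i - \<theta> $ i) = 0" if "\<psi> \<in> X" for \<psi> i
      using vec.independentD[OF ind insert.hyps(1) subset_refl, of "\<lambda>\<psi>. c \<psi> * (\<psi> $ i - \<theta> $ i)"] that by blast
    have "c \<psi> = 0" if "\<psi> \<in> X" for \<psi>
    proof -
      have "\<psi> \<noteq> \<theta>" using that insert.hyps by auto
      then show ?thesis using zero[OF that] by (auto simp: vec_eq_iff)
    qed
    then have "\<theta> = 0" by (simp add: c)
    then show False using insert.prems by (auto simp: algebra_character_def)
  qed
  then show ?case using ind by (simp add: vec.independent_insert insert.hyps)
qed

lemma algebra_characters_finite:
  fixes w :: "'m::finite \<Rightarrow> 'm \<Rightarrow> 'm \<Rightarrow> complex"
  shows "finite {\<psi>. algebra_character w \<psi>}" "card {\<psi>. algebra_character w \<psi>} \<le> CARD('m)"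
proof -
  have le: "finite X \<and> card X \<le> CARD('m)" if "finite X" "X \<subseteq> {\<psi>. algebra_character w \<psi>}" for X
    using vec.independent_card_le_dim[OF subset_UNIV independent_algebra_characters_finite[OF that(1)]] that
    by (auto simp: card_cart_basis)
  show *: "finite {\<psi>. algebra_character w \<psi>}"
  proof (rule ccontr)
    assume "\<not> ?thesis"
    then obtain X where "X \<subseteq> {\<psi>. algebra_character w \<psi>}" "finite X" "card X = Suc CARD('m)"
      by (metis infinite_arbitrarily_large)
    then show False using le by fastforce
  qed
  show "card {\<psi>. algebra_character w \<psi>} \<le> CARD('m)" using le[OF *] by auto
qed

text \<open>
  Gram matrix of the bilinear form that maps \<open>(a, b)\<close> to the trace of multiplication by \<open>a b\<close>; the
  inner sum is the trace of multiplication by the basis element \<open>c\<close>.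
\<close>
definition trace_form :: "('m \<Rightarrow> 'm \<Rightarrow> 'm \<Rightarrow> complex) \<Rightarrow> complex^'m^'m::finite" where
  "trace_form w = (\<chi> l b. \<Sum>c\<in>UNIV. (\<Sum>j\<in>UNIV. w c j j) * w l b c)"

text \<open>
  The matrix \<open>V\<close> whose rows are the characters is invertible and diagonalises all multiplication
  operators at once.  Hence the trace of an element is the sum of its values at the characters, and the
  Gram matrix is \<open>V\<^sup>T V\<close>.
\<close>
lemma trace_form_nondegenerate_if_split:
  fixes w :: "'m::finite \<Rightarrow> 'm \<Rightarrow> 'm \<Rightarrow> complex"
  assumes "card {\<psi>. algebra_character w \<psi>} = CARD('m)"
  shows "det (trace_form w) \<noteq> 0"
proof -
  let ?X = "{\<psi>. algebra_character w \<psi>}"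
  obtain r where r: "bij_betw r (UNIV :: 'm set) ?X"
    using assms finite_same_card_bij[OF finite_class.finite_UNIV algebra_characters_finite(1)] by metis
  define V :: "complex^'m^'m" where "V = (\<chi> p. r p)"
  have ch: "V $ p $ i * V $ p $ j = (\<Sum>l\<in>UNIV. w i j l * V $ p $ l)" for p i j
    using bij_betwE[OF r] by (auto simp: V_def algebra_character_def)
  have rowsV: "rows V = ?X"
    using r by (auto simp: rows_def row_def V_def bij_betw_def image_def)
  have "vec.independent (rows V)"
    using independent_algebra_characters_finite[OF algebra_characters_finite(1)] rowsV by auto
  then have "vec.span (rows V) = UNIV"
    using vec.card_ge_dim_independent[of "rows V" UNIV] assms rowsV by (auto simp: card_cart_basis)
  then have invV: "invertible V"
    using matrix_left_invertible_span_rows_gen invertible_left_inverse by blast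
  then obtain V' where V': "V ** V' = mat 1" "V' ** V = mat 1" by (auto simp: invertible_def)
  have tr: "(\<Sum>j\<in>UNIV. w c j j) = (\<Sum>p\<in>UNIV. V $ p $ c)" for c
  proof -
    define W :: "complex^'m^'m" where "W = (\<chi> i j. w c j i)"
    define D :: "complex^'m^'m" where "D = (\<chi> p q. if p = q then V $ p $ c else 0)"
    have VW: "V ** W = D ** V"
    proof -
      have "(V ** W) $ p $ j = (D ** V) $ p $ j" for p j
      proof -
        have "(V ** W) $ p $ j = (\<Sum>l\<in>UNIV. w c j l * V $ p $ l)"
          by (simp add: matrix_matrix_mult_def W_def mult.commute)
        also have "\<dots> = V $ p $ c * V $ p $ j" by (simp only: ch)
        also have "\<dots> = (D ** V) $ p $ j"
          by (simp add: matrix_matrix_mult_def D_def if_distrib if_distribR cong: if_cong)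
        finally show ?thesis .
      qed
      then show ?thesis by (simp add: vec_eq_iff)
    qed
    have "trace W = trace (V' ** (V ** W))" by (simp add: matrix_mul_assoc V')
    also have "\<dots> = trace ((D ** V) ** V')" unfolding VW by (rule trace_mul_sym)
    also have "\<dots> = trace D" by (simp add: V' flip: matrix_mul_assoc)
    finally show ?thesis by (simp add: trace_def W_def D_def)
  qed
  have "trace_form w = transpose V ** V"
    by (simp add: vec_eq_iff trace_form_def matrix_matrix_mult_def transpose_def tr ch
        sum_distrib_left sum_distrib_right sum.swap[of "\<lambda>c p. V $ p $ c * _ c"] mult.commute)
      (subst sum.swap, simp)
  then have "det (trace_form w) = det V * det V" by (simp add: det_mul)
  then show ?thesis using invV by (simp add: invertible_det_nz)
qed

text \<open>
  Structure constants of a commutative, associative algebra with basis indexed by the type \<open>'m\<close>, whose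
  unit element has the coordinates \<open>u\<close>.
\<close>
locale commutative_algebra_constants =
  fixes w :: "'m::finite \<Rightarrow> 'm \<Rightarrow> 'm \<Rightarrow> complex" and u :: "'m \<Rightarrow> complex"
  assumes comm: "w i j l = w j i l"
    and assoc: "(\<Sum>l\<in>UNIV. w i j l * w l k m) = (\<Sum>l\<in>UNIV. w j k l * w i l m)"
    and unit: "(\<Sum>l\<in>UNIV. u l * w l j m) = (if j = m then 1 else 0)"
begin

definition mult_matrix :: "(complex, 'm) vec \<Rightarrow> complex^'m^'m" where
  "mult_matrix a = (\<chi> m j. \<Sum>i\<in>UNIV. a $ i * w i j m)"

lemma mult_matrix_axis: "mult_matrix (axis b 1) = (\<chi> m j. w b j m)"
  by (simp add: mult_matrix_def axis_def if_distrib if_distribR cong: if_cong)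

lemma mult_matrix_mult:
  "mult_matrix (axis a 1) ** mult_matrix (axis b 1) = mult_matrix (\<chi> l. w a b l)"
  unfolding mult_matrix_axis
  by (simp add: vec_eq_iff matrix_matrix_mult_def mult_matrix_def assoc[symmetric] mult.commute[of "w a _ _"])

lemma mult_matrix_vec: "mult_matrix a *v x = (\<Sum>i\<in>UNIV. a $ i *s (mult_matrix (axis i 1) *v x))"
  unfolding mult_matrix_axis
  by (simp add: vec_eq_iff matrix_vector_mult_def mult_matrix_def sum_distrib_left sum_distrib_right mult.assoc)
    (subst sum.swap, simp)

lemma mult_matrix_commute:
  "mult_matrix (axis a 1) *v (mult_matrix (axis b 1) *v x) = mult_matrix (axis b 1) *v (mult_matrix (axis a 1) *v x)"
  by (simp add: matrix_vector_mul_assoc mult_matrix_mult comm[of a b])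

text \<open>
  The eigenspace of \<open>z\<close> is invariant under all multiplications, which commute, so it contains a common
  eigenvector.  The eigenvalues of the multiplications on that vector form a character.
\<close>
lemma obtain_character_of_eigenvalue:
  assumes "v \<noteq> 0" "mult_matrix a *v v = z *s v"
  obtains \<psi> where "algebra_character w \<psi>" "(\<Sum>l\<in>UNIV. a $ l * \<psi> $ l) = z"
proof -
  let ?L = "\<lambda>b. mult_matrix (axis b 1)"
  define E where "E = {x. mult_matrix a *v x = z *s x}"
  have E: "vec.subspace E"
    unfolding E_def vec.subspace_def
    by (auto simp: matrix_vector_right_distrib vec.scale vec_eq_iff algebra_simps)
  have "mult_matrix a *v (?L b *v x) = ?L b *v (mult_matrix a *v x)" for b x
    unfolding mult_matrix_vec[of a] by (simp add: vec.sum vec.scale mult_matrix_commute[of b])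
  then have inv: "?L b *v x \<in> E" if "x \<in> E" for b x
    using that by (simp add: E_def vec.scale)
  have "\<exists>x\<in>E. x \<noteq> 0 \<and> (\<forall>b\<in>UNIV. \<exists>z. ?L b *v x = z *s x)"
    by (rule common_eigenvector[OF _ mult_matrix_commute E]) (use assms inv in \<open>auto simp: E_def\<close>)
  then obtain x where x: "x \<in> E" "x \<noteq> 0" and "\<forall>b. \<exists>z. ?L b *v x = z *s x" by auto
  then obtain c where c: "\<And>b. ?L b *v x = c b *s x" by metis
  have lin: "mult_matrix b *v x = (\<Sum>l\<in>UNIV. b $ l * c l) *s x" for b
    unfolding mult_matrix_vec[of b] by (simp add: c vec.scale_sum_left)
  have cancel: "p = q" if "p *s x = q *s x" for p q :: complex
    using that x(2) by simp
  have mult: "c i * c j = (\<Sum>l\<in>UNIV. w i j l * c l)" for i j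
  proof (rule cancel)
    have "(c i * c j) *s x = ?L i *v (?L j *v x)" by (simp add: c vec.scale mult.commute)
    also have "\<dots> = mult_matrix (\<chi> l. w i j l) *v x"
      by (simp only: matrix_vector_mul_assoc mult_matrix_mult)
    also have "\<dots> = (\<Sum>l\<in>UNIV. w i j l * c l) *s x"
      by (simp only: lin vec_lambda_beta)
    finally show "(c i * c j) *s x = (\<Sum>l\<in>UNIV. w i j l * c l) *s x" .
  qed
  have "mult_matrix (\<chi> l. u l) = mat 1"
    by (simp add: vec_eq_iff mult_matrix_def unit mat_def eq_commute)
  then have "1 *s x = (\<Sum>l\<in>UNIV. u l * c l) *s x" using lin[of "\<chi> l. u l"] by simp
  then have "(\<Sum>l\<in>UNIV. u l * c l) = 1" by (metis cancel)
  then have "\<exists>l. c l \<noteq> 0" by (metis (no_types, lifting) mult_zero_right sum.neutral zero_neq_one)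
  then have "(\<chi> l. c l) \<noteq> 0" by (simp add: vec_eq_iff)
  then have "algebra_character w (\<chi> l. c l)" using mult by (simp add: algebra_character_def)
  moreover have "(\<Sum>l\<in>UNIV. a $ l * c l) = z"
    using lin[of a] x(1) by (intro cancel) (simp add: E_def)
  ultimately show ?thesis using that[of "\<chi> l. c l"] by simp
qed

text \<open>
  With fewer than \<open>\<mu>\<close> characters there is an element \<open>a \<noteq> 0\<close> killed by all of them.  Then every product
  \<open>a b\<close> is killed too, so multiplication by \<open>a b\<close> has no eigenvalue but 0 and its trace vanishes.  Thus
  \<open>a\<close> lies in the radical of the trace form.
\<close>
lemma split_if_trace_form_nondegenerate:
  assumes "det (trace_form w) \<noteq> 0"
  shows "card {\<psi>. algebra_character w \<psi>} = CARD('m)"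
proof (rule ccontr)
  let ?X = "{\<psi>. algebra_character w \<psi>}"
  assume "card ?X \<noteq> CARD('m)"
  then have less: "card ?X < CARD('m)" using algebra_characters_finite(2)[of w] by simp
  have "card (insert 0 ?X) \<le> CARD('m)"
    using less algebra_characters_finite(1)[of w] by (simp add: card_insert_if)
  then obtain r where r: "range (r :: 'm \<Rightarrow> _) = insert 0 ?X"
    using obtain_enumeration[of "insert 0 ?X"] algebra_characters_finite(1)[of w] by blast
  \<comment> \<open>The rows are 0 and the characters, so the kernel is what all characters kill.\<close>
  define A :: "complex^'m^'m" where "A = (\<chi> p. r p)"
  have rowsA: "rows A = insert 0 ?X"
    using r by (auto simp: rows_def row_def A_def image_def)
  have "vec.dim (rows A) \<le> card ?X"
    using vec.dim_le_card[of "insert 0 ?X" ?X] algebra_characters_finite(1)[of w] rowsA vec.span_superset[of ?X] vec.span_zero[of ?X] by auto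
  then have "vec.span (rows A) \<noteq> UNIV"
  proof (intro notI)
    assume "vec.span (rows A) = UNIV"
    then have "vec.dim (rows A) = vec.dim (UNIV :: (complex^'m) set)"
      using vec.dim_span[of "rows A"] by simp
    then show False
      using less \<open>vec.dim (rows A) \<le> card ?X\<close> by (simp add: vec.dim_UNIV card_cart_basis)
  qed
  then have "det A = 0"
    unfolding matrix_left_invertible_span_rows_gen[symmetric] invertible_left_inverse[symmetric] invertible_det_nz by simp
  then obtain a where a: "a \<noteq> 0" "A *v a = 0" by (rule det_eq_0_obtain_kernel)
  have kill: "(\<Sum>l\<in>UNIV. a $ l * \<psi> $ l) = 0" if "algebra_character w \<psi>" for \<psi>
  proof -
    have "\<psi> \<in> r ` UNIV" unfolding r using that by simp
    then obtain p where "\<psi> = r p" by (rule imageE)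
    then have "(A *v a) $ p = (\<Sum>l\<in>UNIV. a $ l * \<psi> $ l)"
      by (simp add: matrix_vector_mult_def A_def mult.commute)
    then show ?thesis using a by simp
  qed
  have "(\<Sum>l\<in>UNIV. a $ l * trace_form w $ l $ b) = 0" for b
  proof -
    define ab :: "(complex, 'm) vec" where "ab = (\<chi> c. \<Sum>l\<in>UNIV. a $ l * w l b c)"
    have "trace (mult_matrix ab) = 0"
    proof (rule trace_eq_0_if_only_eigenvalue_0)
      fix z v assume "v \<noteq> 0" "mult_matrix ab *v v = z *s v"
      then obtain \<psi> where \<psi>: "algebra_character w \<psi>" "(\<Sum>c\<in>UNIV. ab $ c * \<psi> $ c) = z"
        by (rule obtain_character_of_eigenvalue)
      have "z = (\<Sum>l\<in>UNIV. a $ l * (\<Sum>c\<in>UNIV. w l b c * \<psi> $ c))"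
        unfolding \<psi>(2)[symmetric] ab_def
        by (simp add: sum_distrib_left sum_distrib_right mult.assoc) (subst sum.swap, simp)
      also have "\<dots> = (\<Sum>l\<in>UNIV. a $ l * \<psi> $ l) * \<psi> $ b"
        using \<psi>(1) by (simp add: algebra_character_def sum_distrib_right mult.assoc)
      finally show "z = 0" using kill[OF \<psi>(1)] by simp
    qed
    moreover have "trace (mult_matrix ab) = (\<Sum>c\<in>UNIV. ab $ c * (\<Sum>j\<in>UNIV. w c j j))"
      by (simp add: trace_def mult_matrix_def sum_distrib_left) (subst sum.swap, simp)
    moreover have "\<dots> = (\<Sum>l\<in>UNIV. a $ l * trace_form w $ l $ b)"
    proof -
      define z where "z = (\<lambda>c. \<Sum>j\<in>UNIV. w c j j)"
      have "(\<Sum>c\<in>UNIV. ab $ c * z c) = (\<Sum>c\<in>UNIV. \<Sum>l\<in>UNIV. a $ l * (z c * w l b c))"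
        unfolding ab_def vec_lambda_beta sum_distrib_right by (intro sum.cong refl) simp
      also have "\<dots> = (\<Sum>l\<in>UNIV. a $ l * (\<Sum>c\<in>UNIV. z c * w l b c))"
        by (subst sum.swap) (simp add: sum_distrib_left)
      finally show ?thesis by (simp add: z_def trace_form_def)
    qed
    ultimately show ?thesis by simp
  qed
  then have "transpose (trace_form w) *v a = 0"
    by (simp add: vec_eq_iff matrix_vector_mult_def transpose_def mult.commute)
  moreover have "invertible (transpose (trace_form w))"
    using assms by (simp add: invertible_det_nz det_transpose)
  then obtain B where B: "B ** transpose (trace_form w) = mat 1" by (auto simp: invertible_def)
  ultimately have "mat 1 *v a = B *v 0" by (simp only: flip: B matrix_vector_mul_assoc)
  then show False using a(1) by simp
qed

end

section \<open>Complex differentiability and partial derivatives\<close>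

lemma complex_diff_at_const: "complex_diff_at sc (\<lambda>_. c) z"
  unfolding complex_diff_at_def by (intro exI[of _ "\<lambda>_. 0"]) auto

lemma complex_diff_at_add:
  assumes "complex_diff_at sc f z" "complex_diff_at sc g z"
  shows "complex_diff_at sc (\<lambda>z. f z + g z) z"
proof -
  obtain D E where "(f has_derivative D) (at z)" "\<forall>c h. D (sc c h) = c * D h"
    "(g has_derivative E) (at z)" "\<forall>c h. E (sc c h) = c * E h"
    using assms by (auto simp: complex_diff_at_def)
  then show ?thesis unfolding complex_diff_at_def
    by (intro exI[of _ "\<lambda>h. D h + E h"]) (auto intro!: has_derivative_add simp: algebra_simps)
qed

lemma complex_diff_at_mult:
  assumes "complex_diff_at sc f z" "complex_diff_at sc g z"
  shows "complex_diff_at sc (\<lambda>z. f z * g z) z"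
proof -
  obtain D E where "(f has_derivative D) (at z)" "\<forall>c h. D (sc c h) = c * D h"
    "(g has_derivative E) (at z)" "\<forall>c h. E (sc c h) = c * E h"
    using assms by (auto simp: complex_diff_at_def)
  then show ?thesis unfolding complex_diff_at_def
    by (intro exI[of _ "\<lambda>h. f z * E h + D h * g z"] conjI has_derivative_mult) (auto simp: algebra_simps)
qed

lemma complex_diff_at_inverse:
  assumes "complex_diff_at sc f z" "f z \<noteq> 0"
  shows "complex_diff_at sc (\<lambda>z. inverse (f z)) z"
proof -
  obtain D where "(f has_derivative D) (at z)" "\<forall>c h. D (sc c h) = c * D h"
    using assms by (auto simp: complex_diff_at_def)
  then show ?thesis unfolding complex_diff_at_def
    by (intro exI[of _ "\<lambda>h. - (inverse (f z) * D h * inverse (f z))"] conjI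
        Deriv.has_derivative_inverse[where f = f] assms(2)) (auto simp: algebra_simps)
qed

lemma complex_diff_at_sum:
  "(\<And>i. i \<in> I \<Longrightarrow> complex_diff_at sc (f i) z) \<Longrightarrow> complex_diff_at sc (\<lambda>z. \<Sum>i\<in>I. f i z) z"
  by (induction I rule: infinite_finite_induct) (auto intro!: complex_diff_at_const complex_diff_at_add)

lemma complex_diff_at_prod:
  "(\<And>i. i \<in> I \<Longrightarrow> complex_diff_at sc (f i) z) \<Longrightarrow> complex_diff_at sc (\<lambda>z. \<Prod>i\<in>I. f i z) z"
  by (induction I rule: infinite_finite_induct) (auto intro!: complex_diff_at_const complex_diff_at_mult)

lemma complex_diff_at_bounded_linear:
  assumes "bounded_linear f" "\<And>c h. f (sc c h) = c * f h"
  shows "complex_diff_at sc f z"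
  unfolding complex_diff_at_def using assms bounded_linear_imp_has_derivative by blast

lemma complex_diff_at_affine:
  assumes "complex_diff_at sc' f (a + L z)" "bounded_linear L" "\<And>c h. L (sc c h) = sc' c (L h)"
  shows "complex_diff_at sc (\<lambda>z. f (a + L z)) z"
proof -
  obtain D where D: "(f has_derivative D) (at (a + L z))" "\<forall>c h. D (sc' c h) = c * D h"
    using assms by (auto simp: complex_diff_at_def)
  have "((\<lambda>z. a + L z) has_derivative L) (at z)"
    using has_derivative_add[OF has_derivative_const bounded_linear_imp_has_derivative[OF assms(2)]] by simp
  then have "((\<lambda>z. f (a + L z)) has_derivative (\<lambda>h. D (L h))) (at z)"
    using D(1) by (rule has_derivative_compose)
  then show ?thesis unfolding complex_diff_at_def using D(2) assms(3) by auto
qed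

lemma complex_diff_at_continuous: "complex_diff_at sc f z \<Longrightarrow> isCont f z"
  by (auto simp: complex_diff_at_def dest: has_derivative_continuous)

lemma complex_diff_at_transform:
  assumes "complex_diff_at sc f z" "open W" "z \<in> W" "\<And>w. w \<in> W \<Longrightarrow> f w = g w"
  shows "complex_diff_at sc g z"
  using assms has_derivative_transform_within_open unfolding complex_diff_at_def by blast

definition partial_deriv :: "(complex \<Rightarrow> 'a \<Rightarrow> 'a) \<Rightarrow> 'a \<Rightarrow> ('a::real_normed_vector \<Rightarrow> complex) \<Rightarrow> 'a \<Rightarrow> complex" where
  "partial_deriv sc v f z = deriv (\<lambda>w. f (z + sc w v)) 0"

text \<open>
  What is used of a complex vector space structure, given by an explicit scalar multiplication, on a
  Euclidean space.
\<close>
locale complex_scaling =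
  fixes sc :: "complex \<Rightarrow> 'a::euclidean_space \<Rightarrow> 'a"
  assumes bounded_linear_left: "bounded_linear (\<lambda>c. sc c v)"
    and sc_one: "sc 1 v = v"
begin

lemma has_field_derivative_on_line:
  assumes "(f has_derivative D) (at (z + sc w0 v))" "\<forall>c h. D (sc c h) = c * D h"
  shows "((\<lambda>w. f (z + sc w v)) has_field_derivative D v) (at w0)"
proof -
  have "((\<lambda>w. z + sc w v) has_derivative (\<lambda>w. sc w v)) (at w0)"
    using has_derivative_add[OF has_derivative_const bounded_linear_imp_has_derivative[OF bounded_linear_left]] by simp
  from has_derivative_compose[OF this assms(1)]
  have "((\<lambda>w. f (z + sc w v)) has_derivative (\<lambda>w. D (sc w v))) (at w0)" .
  moreover have "(\<lambda>w. D (sc w v)) = (*) (D v)" using assms(2) by (auto simp: mult.commute)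
  ultimately show ?thesis unfolding has_field_derivative_def by simp
qed

lemma partial_deriv_eq:
  assumes "(f has_derivative D) (at z)" "\<forall>c h. D (sc c h) = c * D h"
  shows "partial_deriv sc v f z = D v"
proof -
  have "sc 0 v = 0" using bounded_linear_left linear_simps(3) by blast
  then show ?thesis
    unfolding partial_deriv_def
    by (intro DERIV_imp_deriv has_field_derivative_on_line) (use assms in auto)
qed

text \<open>
  The total derivative is the map that sends a direction to the partial derivative in it.  This
  describes the derivative by complex functions of the base point.
\<close>
lemma has_derivative_partial_deriv:
  assumes "complex_diff_at sc f z"
  shows "(f has_derivative (\<lambda>v. partial_deriv sc v f z)) (at z)"
    and "partial_deriv sc (sc c v) f z = c * partial_deriv sc v f z"
proof -
  obtain D where D: "(f has_derivative D) (at z)" "\<forall>c h. D (sc c h) = c * D h"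
    using assms by (auto simp: complex_diff_at_def)
  have eq: "partial_deriv sc v f z = D v" for v by (rule partial_deriv_eq[OF D])
  show "(f has_derivative (\<lambda>v. partial_deriv sc v f z)) (at z)" using D(1) by (simp add: eq)
  show "partial_deriv sc (sc c v) f z = c * partial_deriv sc v f z" using D(2) by (simp add: eq)
qed

lemma bounded_linear_partial_deriv:
  "complex_diff_at sc f z \<Longrightarrow> bounded_linear (\<lambda>v. partial_deriv sc v f z)"
  using has_derivative_bounded_linear[OF has_derivative_partial_deriv(1)] .

lemma partial_deriv_affine:
  assumes "complex_diff_at sc f (a + L z)" "bounded_linear L" "\<And>c h. L (sc c h) = sc c (L h)"
  shows "partial_deriv sc v (\<lambda>z. f (a + L z)) z = partial_deriv sc (L v) f (a + L z)"
proof -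
  have "((\<lambda>z. a + L z) has_derivative L) (at z)"
    using has_derivative_add[OF has_derivative_const bounded_linear_imp_has_derivative[OF assms(2)]] by simp
  then have "((\<lambda>z. f (a + L z)) has_derivative (\<lambda>v. partial_deriv sc (L v) f (a + L z))) (at z)"
    using has_derivative_partial_deriv(1)[OF assms(1)] by (rule has_derivative_compose)
  then show ?thesis
    by (rule partial_deriv_eq) (simp add: assms(3) has_derivative_partial_deriv(2)[OF assms(1)])
qed

abbreviation (input) circ :: "real \<Rightarrow> real \<Rightarrow> complex" where
  "circ r t \<equiv> of_real r * exp (2 * of_real pi * \<i> * of_real t)"

text \<open>
  Cauchy's formula on the circle of radius \<open>r\<close> in the complex line through \<open>z\<close> in direction \<open>v\<close>, with the
  same circle for all \<open>z\<close> near \<open>z0\<close>.  It expresses a derivative of \<open>f\<close> by an integral over values of \<open>f\<close>,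
  which then may be studied as a function of \<open>z\<close>.
\<close>
lemma partial_deriv_Cauchy:
  assumes "open W" and f: "\<And>z. z \<in> W \<Longrightarrow> complex_diff_at sc f z" and z0: "z0 \<in> W"
  obtains e r where "e > 0" "r > 0"
    "\<And>z w. z \<in> ball z0 e \<Longrightarrow> norm w \<le> r \<Longrightarrow> z + sc w v \<in> W"
    "\<And>z. z \<in> ball z0 e \<Longrightarrow>
       partial_deriv sc v f z = integral {0..1} (\<lambda>t. f (z + sc (circ r t) v) / circ r t)"
proof -
  obtain d where d: "d > 0" "ball z0 d \<subseteq> W" using \<open>open W\<close> z0 open_contains_ball by blast
  obtain K where K: "K > 0" "\<And>w. norm (sc w v) \<le> norm w * K"
    using bounded_linear.pos_bounded[OF bounded_linear_left[of v]] by blast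
  \<comment> \<open>Moving the centre uses up half of \<open>d\<close>, the circle a quarter.\<close>
  define e where "e = d / 2"
  define r where "r = d / (4 * K)"
  have pos: "e > 0" "r > 0" using d K by (auto simp: e_def r_def)
  have inW: "z + sc w v \<in> W" if "z \<in> ball z0 e" "norm w \<le> r" for z w
  proof -
    have "norm (sc w v) \<le> r * K" using K(2)[of w] that(2) K(1) by (meson mult_right_mono less_imp_le order_trans)
    then have "norm (sc w v) < d / 2" using K(1) d(1) by (simp add: r_def)
    moreover have "dist z0 (z + sc w v) \<le> dist z0 z + norm (sc w v)"
      by (metis dist_add_cancel dist_norm dist_triangle add_diff_cancel_left' norm_minus_commute)
    ultimately have "z + sc w v \<in> ball z0 d" using that(1) by (simp add: e_def)
    then show ?thesis using d(2) by auto
  qed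
  have Cauchy: "partial_deriv sc v f z = integral {0..1} (\<lambda>t. f (z + sc (circ r t) v) / circ r t)"
    if z: "z \<in> ball z0 e" for z
  proof -
    let ?g = "\<lambda>w. f (z + sc w v)"
    have der: "\<exists>D. (?g has_field_derivative D) (at w)" if "norm w \<le> r" for w
      using f[OF inW[OF z that]] has_field_derivative_on_line unfolding complex_diff_at_def by blast
    have "continuous_on (cball 0 r) ?g"
      by (intro continuous_at_imp_continuous_on ballI) (metis der DERIV_isCont mem_cball_0)
    moreover have "?g holomorphic_on ball 0 r"
      unfolding holomorphic_on_def field_differentiable_def
      by (intro ballI) (metis der has_field_derivative_at_within less_imp_le mem_ball_0)
    ultimately have "(?g has_field_derivative (1 / (2 * of_real pi * \<i>) *
        contour_integral (circlepath 0 r) (\<lambda>u. ?g u / (u - 0)^2))) (at 0)"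
      by (rule Cauchy_derivative_integral_circlepath(2)) (simp add: pos)
    then have "partial_deriv sc v f z = 1 / (2 * of_real pi * \<i>) *
        contour_integral (circlepath 0 r) (\<lambda>u. ?g u / (u - 0)^2)"
      unfolding partial_deriv_def by (rule DERIV_imp_deriv)
    also have "\<dots> = 1 / (2 * of_real pi * \<i>) *
        integral {0..1} (\<lambda>t. 2 * of_real pi * \<i> * (?g (circ r t) / circ r t))"
    proof -
      have "?g (circlepath 0 r t) / (circlepath 0 r t - 0)^2 * vector_derivative (circlepath 0 r) (at t) =
          2 * of_real pi * \<i> * (?g (circ r t) / circ r t)" for t
      proof -
        have cancel: "a / c\<^sup>2 * (b * c) = b * (a / c)" if "c \<noteq> 0" for a b c :: complex
          using that by (simp add: power2_eq_square)
        have "circlepath 0 r t = circ r t"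
          by (simp add: circlepath_def part_circlepath_def linepath_def mult_ac)
        moreover have "vector_derivative (circlepath 0 r) (at t) = (2 * of_real pi * \<i>) * circ r t"
          by (simp add: vector_derivative_circlepath mult_ac)
        moreover have "circ r t \<noteq> 0" using pos by simp
        ultimately show ?thesis by (simp only: diff_zero) (rule cancel)
      qed
      then show ?thesis unfolding contour_integral_integral by (simp only:)
    qed
    also have "\<dots> = integral {0..1} (\<lambda>t. ?g (circ r t) / circ r t)"
      by (subst integral_mult_right) simp
    finally show ?thesis .
  qed
  show ?thesis by (rule that[OF pos inW Cauchy])
qed

lemma continuous_on_sc: "continuous_on S g \<Longrightarrow> continuous_on S (\<lambda>x. sc (g x) v)"
  using bounded_linear.continuous_on[OF bounded_linear_left] .

lemma circ_norm: "r > 0 \<Longrightarrow> norm (circ r t) = r"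
  by (simp add: norm_mult)

text \<open>
  The integrand in Cauchy's formula contains only values of \<open>f\<close>, so it is continuous in \<open>z\<close>.
\<close>
lemma continuous_on_partial_deriv:
  assumes "open W" and f: "\<And>z. z \<in> W \<Longrightarrow> complex_diff_at sc f z"
  shows "continuous_on W (partial_deriv sc v f)"
proof (rule continuous_at_imp_continuous_on, rule ballI)
  fix z0 assume "z0 \<in> W"
  then obtain e r where er: "e > 0" "r > 0"
    and inW: "\<And>z w. z \<in> ball z0 e \<Longrightarrow> norm w \<le> r \<Longrightarrow> z + sc w v \<in> W"
    and eq: "\<And>z. z \<in> ball z0 e \<Longrightarrow>
       partial_deriv sc v f z = integral {0..1} (\<lambda>t. f (z + sc (circ r t) v) / circ r t)"
    using partial_deriv_Cauchy[OF assms] by blast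
  have contf: "continuous_on W f" by (intro continuous_at_imp_continuous_on ballI complex_diff_at_continuous[OF f])
  have "(\<lambda>x. fst x + sc (circ r (snd x)) v) ` (ball z0 e \<times> cbox 0 1) \<subseteq> W"
    by (rule image_subsetI, rule inW) (auto simp: circ_norm[OF er(2)])
  moreover have "continuous_on (ball z0 e \<times> cbox 0 1) (\<lambda>x. fst x + sc (circ r (snd x)) v)"
    by (intro continuous_intros continuous_on_sc)
  ultimately have "continuous_on (ball z0 e \<times> cbox 0 1) (\<lambda>x. f (fst x + sc (circ r (snd x)) v))"
    by (rule continuous_on_compose2[OF contf, rotated])
  then have "continuous_on (ball z0 e \<times> cbox 0 1) (\<lambda>(z, t). f (z + sc (circ r t) v) / circ r t)"
    unfolding split_beta
    by (rule continuous_on_divide) (use er in \<open>auto intro!: continuous_intros\<close>)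
  from integral_continuous_on_param[OF this]
  have "continuous_on (ball z0 e) (partial_deriv sc v f)"
    by (rule continuous_on_eq) (simp add: eq cbox_interval)
  then show "isCont (partial_deriv sc v f) z0"
    using er by (simp add: continuous_on_eq_continuous_at)
qed

text \<open>
  Differentiation under the integral sign.  The total derivative of the integrand depends continuously
  on all arguments because its values on the real basis vectors do.
\<close>
lemma complex_diff_at_integral:
  fixes g :: "'a \<Rightarrow> real \<Rightarrow> complex"
  assumes "open B" "convex B" "z0 \<in> B"
    and g: "\<And>z t. z \<in> B \<Longrightarrow> t \<in> {0..1} \<Longrightarrow> complex_diff_at sc (\<lambda>z. g z t) z"
    and cont: "\<And>z. z \<in> B \<Longrightarrow> continuous_on {0..1} (g z)"
    and cont': "\<And>v. continuous_on (B \<times> {0..1}) (\<lambda>(z, t). partial_deriv sc v (\<lambda>z. g z t) z)"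
  shows "complex_diff_at sc (\<lambda>z. integral {0..1} (g z)) z0"
proof -
  define D where "D z t = (if z \<in> B \<and> t \<in> {0..1} then Blinfun (\<lambda>v. partial_deriv sc v (\<lambda>z. g z t) z) else 0)" for z t
  have D: "blinfun_apply (D z t) v = partial_deriv sc v (\<lambda>z. g z t) z" if "z \<in> B" "t \<in> {0..1}" for z t v
    using that by (simp add: D_def bounded_linear_Blinfun_apply bounded_linear_partial_deriv[OF g])
  have contD: "continuous_on (B \<times> {0..1}) (\<lambda>(z, t). D z t)"
    unfolding split_beta
  proof (rule continuous_on_blinfun_componentwise)
    fix i :: 'a
    show "continuous_on (B \<times> {0..1}) (\<lambda>x. blinfun_apply (D (fst x) (snd x)) i)"
      using cont'[of i] by (rule continuous_on_eq) (auto simp: D)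
  qed
  have contD0: "continuous_on {0..1} (D z0)"
    using continuous_on_compose2[OF contD continuous_on_Pair[OF continuous_on_const continuous_on_id], of z0 "{0..1}"]
      \<open>z0 \<in> B\<close> by auto
  have "((\<lambda>z. integral (cbox 0 1) (g z)) has_derivative integral (cbox 0 1) (D z0)) (at z0 within B)"
  proof (rule leibniz_rule)
    fix z t assume z: "z \<in> B" "t \<in> cbox 0 (1::real)"
    then have "((\<lambda>z. g z t) has_derivative (\<lambda>v. partial_deriv sc v (\<lambda>z. g z t) z)) (at z)"
      by (intro has_derivative_partial_deriv(1) g) (auto simp: cbox_interval)
    moreover have "blinfun_apply (D z t) = (\<lambda>v. partial_deriv sc v (\<lambda>z. g z t) z)"
      using z by (intro ext D) (auto simp: cbox_interval)
    ultimately show "((\<lambda>z. g z t) has_derivative blinfun_apply (D z t)) (at z within B)"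
      by (simp add: has_derivative_at_withinI)
  next
    show "g z integrable_on cbox 0 1" if "z \<in> B" for z
      using cont[OF that] by (auto simp: cbox_interval intro: integrable_continuous_interval)
    show "continuous_on (B \<times> cbox 0 1) (\<lambda>(z, t). D z t)" using contD by (simp add: cbox_interval)
    show "z0 \<in> B" by (rule assms(3))
    show "convex B" by (rule assms(2))
  qed
  then have der: "((\<lambda>z. integral {0..1} (g z)) has_derivative integral {0..1} (D z0)) (at z0)"
    unfolding at_within_open[OF \<open>z0 \<in> B\<close> \<open>open B\<close>] cbox_interval .
  have int: "D z0 integrable_on {0..1}" using contD0 by (rule integrable_continuous_interval)
  have "blinfun_apply (integral {0..1} (D z0)) (sc c h) = c * blinfun_apply (integral {0..1} (D z0)) h" for c h
  proof -
    have "blinfun_apply (integral {0..1} (D z0)) (sc c h) = integral {0..1} (\<lambda>t. c * blinfun_apply (D z0 t) h)"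
      unfolding blinfun_apply_integral[OF int]
      by (intro integral_cong) (simp add: D \<open>z0 \<in> B\<close> has_derivative_partial_deriv(2) g)
    also have "\<dots> = c * blinfun_apply (integral {0..1} (D z0)) h"
      by (simp add: blinfun_apply_integral[OF int] integral_mult_right)
    finally show ?thesis .
  qed
  with der show ?thesis unfolding complex_diff_at_def by blast
qed

text \<open>
  Differentiate Cauchy's formula under the integral; the derivatives of the integrand are continuous by
  \<open>continuous_on_partial_deriv\<close>.
\<close>
lemma complex_diff_at_partial_deriv:
  assumes "open W" and f: "\<And>z. z \<in> W \<Longrightarrow> complex_diff_at sc f z" and "z0 \<in> W"
  shows "complex_diff_at sc (partial_deriv sc v f) z0"
proof -
  obtain e r where er: "e > 0" "r > 0"
    and inW: "\<And>z w. z \<in> ball z0 e \<Longrightarrow> norm w \<le> r \<Longrightarrow> z + sc w v \<in> W"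
    and eq: "\<And>z. z \<in> ball z0 e \<Longrightarrow>
       partial_deriv sc v f z = integral {0..1} (\<lambda>t. f (z + sc (circ r t) v) / circ r t)"
    using partial_deriv_Cauchy[OF assms] by blast
  have contf: "continuous_on W f" by (intro continuous_at_imp_continuous_on ballI complex_diff_at_continuous[OF f])
  let ?g = "\<lambda>z t. inverse (circ r t) * f (sc (circ r t) v + z)"
  have shift: "complex_diff_at sc f (sc (circ r t) v + z)" if "z \<in> ball z0 e" for z t
    using f[OF inW[OF that, of "circ r t"]] er by (simp add: norm_mult add.commute)
  have shift': "complex_diff_at sc (\<lambda>z. f (sc (circ r t) v + z)) z" if "z \<in> ball z0 e" for z t
    using complex_diff_at_affine[OF shift[OF that] bounded_linear_ident] by simp
  have pd: "partial_deriv sc u (\<lambda>z. ?g z t) z = inverse (circ r t) * partial_deriv sc u f (sc (circ r t) v + z)"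
    if "z \<in> ball z0 e" for z t u
  proof -
    have 1: "((\<lambda>z. f (sc (circ r t) v + z)) has_derivative (\<lambda>u. partial_deriv sc u f (sc (circ r t) v + z))) (at z)"
      using has_derivative_partial_deriv(1)[OF shift'[OF that]]
        partial_deriv_affine[OF shift[OF that] bounded_linear_ident] by simp
    show ?thesis
      by (rule partial_deriv_eq[OF has_derivative_mult_right[OF 1]])
        (simp add: has_derivative_partial_deriv(2)[OF shift[OF that]])
  qed
  have "complex_diff_at sc (\<lambda>z. integral {0..1} (?g z)) z0"
  proof (rule complex_diff_at_integral[of "ball z0 e"])
    show "complex_diff_at sc (\<lambda>z. ?g z t) z" if "z \<in> ball z0 e" for z t
      by (intro complex_diff_at_mult complex_diff_at_const shift' that)
    show "continuous_on {0..1} (?g z)" if "z \<in> ball z0 e" for z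
    proof -
      have "(\<lambda>t. sc (circ r t) v + z) ` {0..1} \<subseteq> W"
        by (rule image_subsetI, subst add.commute, rule inW[OF that]) (simp add: circ_norm[OF er(2)])
      moreover have "continuous_on {0..1} (\<lambda>t. sc (circ r t) v + z)"
        by (intro continuous_intros continuous_on_sc)
      ultimately have "continuous_on {0..1} (\<lambda>t. f (sc (circ r t) v + z))"
        by (rule continuous_on_compose2[OF contf, rotated])
      moreover have "continuous_on {0..1} (\<lambda>t. inverse (circ r t))"
        using er by (intro continuous_on_inverse continuous_intros) auto
      ultimately show ?thesis by (intro continuous_on_mult)
    qed
    show "continuous_on (ball z0 e \<times> {0..1}) (\<lambda>(z, t). partial_deriv sc u (\<lambda>z. ?g z t) z)" for u
    proof (rule continuous_on_eq)
      show "continuous_on (ball z0 e \<times> {0..1}) (\<lambda>x. inverse (circ r (snd x)) *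
          partial_deriv sc u f (sc (circ r (snd x)) v + fst x))"
      proof -
        have cpd: "continuous_on W (partial_deriv sc u f)"
          by (rule continuous_on_partial_deriv[OF assms(1)]) (rule f)
        have "(\<lambda>x. sc (circ r (snd x)) v + fst x) ` (ball z0 e \<times> {0..1::real}) \<subseteq> W"
          by (rule image_subsetI, subst add.commute, rule inW) (auto simp: circ_norm[OF er(2)])
        moreover have "continuous_on (ball z0 e \<times> {0..1}) (\<lambda>x. sc (circ r (snd x)) v + fst x)"
          by (intro continuous_intros continuous_on_sc)
        ultimately have "continuous_on (ball z0 e \<times> {0..1})
            (\<lambda>x. partial_deriv sc u f (sc (circ r (snd x)) v + fst x))"
          by (rule continuous_on_compose2[OF cpd, rotated])
        moreover have "continuous_on (ball z0 e \<times> {0..1}) (\<lambda>x. inverse (circ r (snd x)))"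
          using er by (intro continuous_on_inverse continuous_intros) auto
        ultimately show ?thesis by (intro continuous_on_mult)
      qed
      fix x assume "x \<in> ball z0 e \<times> {0..1::real}"
      then have "fst x \<in> ball z0 e" by auto
      then show "inverse (circ r (snd x)) * partial_deriv sc u f (sc (circ r (snd x)) v + fst x) =
          (case x of (z, t) \<Rightarrow> partial_deriv sc u (\<lambda>z. ?g z t) z)"
        by (simp only: split_beta pd)
    qed
  qed (use er in auto)
  then show ?thesis
    by (rule complex_diff_at_transform[of _ _ _ "ball z0 e"]) (use er eq in \<open>auto simp: field_simps add.commute\<close>)
qed

end

lemma bounded_linear_vector_scalar_mult_left: "bounded_linear (\<lambda>c::complex. c *s (v :: complex^'n))"
  unfolding linear_conv_bounded_linear[symmetric]
  by (rule linearI) (simp_all add: vec_eq_iff algebra_simps)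

lemma bounded_linear_scale_xs_left: "bounded_linear (\<lambda>c. scale_xs c v)"
  by (cases v) (simp only: map_prod_simp, intro bounded_linear_Pair bounded_linear_vector_scalar_mult_left)

interpretation xs: complex_scaling "scale_xs :: complex \<Rightarrow> (complex^'n) \<times> (complex^'m) \<Rightarrow> _"
proof (rule complex_scaling.intro)
  show "bounded_linear (\<lambda>c. scale_xs c v)" for v :: "(complex^'n) \<times> (complex^'m)"
    by (rule bounded_linear_scale_xs_left)
  show "scale_xs 1 v = v" for v :: "(complex^'n) \<times> (complex^'m)"
    by (cases v) simp
qed

lemma scaleR_vector_scalar_mult: "t *\<^sub>R (c *s x) = c *s (t *\<^sub>R (x :: complex^'n))"
  by (simp add: vec_eq_iff)

section \<open>Germs of holomorphic functions\<close>

text \<open>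
  The tube lemma: a property of germs along a compact slice holds uniformly for all nearby parameters.
\<close>
lemma eventually_nhds_compact_slice:
  assumes "compact K" and P: "\<And>x. x \<in> K \<Longrightarrow> \<forall>\<^sub>F z in nhds (x, y). P z"
  shows "\<forall>\<^sub>F s in nhds y. \<forall>x\<in>K. P (x, s)"
proof -
  define W where "W = {(s, x). (x, s) \<in> interior {z. P z}}"
  have "W = prod.swap -` interior {z. P z}" by (auto simp: W_def)
  then have "open W" by (simp add: open_vimage continuous_on_swap)
  moreover have "{y} \<times> K \<subseteq> W"
  proof clarify
    fix x assume "x \<in> K"
    then obtain S where "open S" "(x, y) \<in> S" "\<forall>z\<in>S. P z"
      using P unfolding eventually_nhds by metis
    then show "(y, x) \<in> W" unfolding W_def by (auto intro: interiorI)
  qed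
  ultimately obtain Y where Y: "y \<in> Y" "open Y" "Y \<times> K \<subseteq> W"
    using Elementary_Topology.tube_lemma[OF \<open>compact K\<close>] by metis
  have "P (x, s)" if "s \<in> Y" "x \<in> K" for s x
    using Y(3) that interior_subset[of "{z. P z}"] by (auto simp: W_def)
  then show ?thesis unfolding eventually_nhds using Y by blast
qed

lemma isCont_tendsto_nhds: "isCont f x \<Longrightarrow> (f \<longlongrightarrow> f x) (nhds x)"
  by (simp add: isCont_def tendsto_at_iff_tendsto_nhds)

lemma hol_germs_open:
  assumes "f \<in> hol_germs sc K"
  obtains W where "open W" "K \<subseteq> W" "\<And>z. z \<in> W \<Longrightarrow> complex_diff_at sc f z"
proof
  show "open (interior {z. complex_diff_at sc f z})" by simp
  show "K \<subseteq> interior {z. complex_diff_at sc f z}"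
  proof
    fix z assume "z \<in> K"
    then obtain S where "open S" "z \<in> S" "\<forall>y\<in>S. complex_diff_at sc f y"
      using assms unfolding hol_germs_def eventually_nhds by blast
    then show "z \<in> interior {z. complex_diff_at sc f z}" by (intro interiorI[of S]) auto
  qed
qed (use interior_subset in blast)

lemma hol_germsI_open:
  assumes "open W" "K \<subseteq> W" "\<And>z. z \<in> W \<Longrightarrow> complex_diff_at sc f z"
  shows "f \<in> hol_germs sc K"
  unfolding hol_germs_def eventually_nhds using assms by blast

lemma hol_germs_complex_diff: "f \<in> hol_germs sc K \<Longrightarrow> z \<in> K \<Longrightarrow> complex_diff_at sc f z"
  unfolding hol_germs_def using eventually_nhds_x_imp_x by fastforce

lemma hol_germs_isCont: "f \<in> hol_germs sc K \<Longrightarrow> z \<in> K \<Longrightarrow> isCont f z"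
  using complex_diff_at_continuous hol_germs_complex_diff by metis

lemma hol_germs_const: "(\<lambda>_. c) \<in> hol_germs sc K"
  by (auto simp: hol_germs_def intro!: always_eventually complex_diff_at_const)

lemma hol_germs_lift2:
  assumes "f \<in> hol_germs sc K" "g \<in> hol_germs sc K"
    and "\<And>z. complex_diff_at sc f z \<Longrightarrow> complex_diff_at sc g z \<Longrightarrow> complex_diff_at sc h z"
  shows "h \<in> hol_germs sc K"
  unfolding hol_germs_def
proof safe
  fix z assume "z \<in> K"
  then have "\<forall>\<^sub>F y in nhds z. complex_diff_at sc f y" "\<forall>\<^sub>F y in nhds z. complex_diff_at sc g y"
    using assms by (auto simp: hol_germs_def)
  then show "\<forall>\<^sub>F y in nhds z. complex_diff_at sc h y"
    by eventually_elim (rule assms(3))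
qed

lemma hol_germs_add: "f \<in> hol_germs sc K \<Longrightarrow> g \<in> hol_germs sc K \<Longrightarrow> (\<lambda>z. f z + g z) \<in> hol_germs sc K"
  by (rule hol_germs_lift2[of f _ _ g]) (auto intro: complex_diff_at_add)

lemma hol_germs_mult: "f \<in> hol_germs sc K \<Longrightarrow> g \<in> hol_germs sc K \<Longrightarrow> (\<lambda>z. f z * g z) \<in> hol_germs sc K"
  by (rule hol_germs_lift2[of f _ _ g]) (auto intro: complex_diff_at_mult)

lemma hol_germs_diff: "f \<in> hol_germs sc K \<Longrightarrow> g \<in> hol_germs sc K \<Longrightarrow> (\<lambda>z. f z - g z) \<in> hol_germs sc K"
  using hol_germs_add[of f sc K "\<lambda>z. (- 1) * g z"] hol_germs_mult[OF hol_germs_const[of "- 1"], of g] by simp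

lemma hol_germs_sum:
  "(\<And>i. i \<in> I \<Longrightarrow> f i \<in> hol_germs sc K) \<Longrightarrow> (\<lambda>z. \<Sum>i\<in>I. f i z) \<in> hol_germs sc K"
  by (induction I rule: infinite_finite_induct) (auto intro!: hol_germs_const hol_germs_add)

lemma hol_germs_inverse:
  assumes f: "f \<in> hol_germs sc K" and nz: "\<And>z. z \<in> K \<Longrightarrow> f z \<noteq> 0"
  shows "(\<lambda>z. inverse (f z)) \<in> hol_germs sc K"
  unfolding hol_germs_def
proof safe
  fix z assume z: "z \<in> K"
  have "\<forall>\<^sub>F y in nhds z. f y \<noteq> 0"
    using hol_germs_isCont[OF f z] nz[OF z] by (metis isCont_def tendsto_at_iff_tendsto_nhds tendsto_imp_eventually_ne)
  moreover have "\<forall>\<^sub>F y in nhds z. complex_diff_at sc f y" using f z by (auto simp: hol_germs_def)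
  ultimately show "\<forall>\<^sub>F y in nhds z. complex_diff_at sc (\<lambda>z. inverse (f z)) y"
    by eventually_elim (rule complex_diff_at_inverse)
qed

lemmas hol_germs_intros = hol_germs_const hol_germs_add hol_germs_mult hol_germs_diff hol_germs_sum

lemma hol_germs_affine:
  assumes f: "f \<in> hol_germs sc' K'" and L: "bounded_linear L" "\<And>c h. L (sc c h) = sc' c (L h)"
    and K: "\<And>z. z \<in> K \<Longrightarrow> a + L z \<in> K'"
  shows "(\<lambda>z. f (a + L z)) \<in> hol_germs sc K"
proof -
  obtain W where W: "open W" "K' \<subseteq> W" "\<And>z. z \<in> W \<Longrightarrow> complex_diff_at sc' f z"
    using f by (rule hol_germs_open) blast
  show ?thesis
  proof (rule hol_germsI_open)
    show "open ((\<lambda>z. a + L z) -` W)"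
      by (intro open_vimage W continuous_intros linear_continuous_on L)
  qed (use W K L in \<open>auto intro!: complex_diff_at_affine\<close>)
qed

lemma hol_germs_snd: "a \<in> hol_germs (*s) {0} \<Longrightarrow> (\<lambda>z. a (snd z)) \<in> hol_germs scale_xs (K \<times> {0})"
  using hol_germs_affine[of a "(*s)" "{0}" snd scale_xs "K \<times> {0}" 0] bounded_linear_snd by auto

lemma hol_germs_fst: "f \<in> hol_germs (*s) K \<Longrightarrow> (\<lambda>z. f (fst z)) \<in> hol_germs scale_xs (K \<times> {0})"
  using hol_germs_affine[of f "(*s)" K fst scale_xs "K \<times> {0}" 0] bounded_linear_fst by auto

lemma hol_germs_slice:
  assumes "f \<in> hol_germs scale_xs (K \<times> {0})" "q \<in> K"
  shows "(\<lambda>s. f (q, s)) \<in> hol_germs (*s) {0}"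
  using hol_germs_affine[of f scale_xs "K \<times> {0}" "Pair 0" "(*s)" "{0}" "(q, 0)"] assms
    bounded_linear_Pair[OF bounded_linear_zero bounded_linear_ident]
  by simp

lemma hol_germs_coordinate: "(\<lambda>z :: (complex^'n) \<times> (complex^'m). fst z $ i) \<in> hol_germs scale_xs K"
proof (rule hol_germsI_open[OF open_UNIV])
  show "complex_diff_at scale_xs (\<lambda>z. fst z $ i) z" for z :: "(complex^'n) \<times> (complex^'m)"
    by (rule complex_diff_at_bounded_linear)
      (auto intro: bounded_linear_compose[OF bounded_linear_vec_nth bounded_linear_fst])
qed auto

lemma germ_eq_refl: "germ_eq K f f"
  by (simp add: germ_eq_def)

lemma germ_span_cong:
  assumes "h \<in> germ_span sc K scm G" "germ_eq K h h'"
  shows "h' \<in> germ_span sc K scm G"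
proof -
  obtain a where a: "\<forall>g\<in>G. a g \<in> hol_germs sc K" "germ_eq K h (\<lambda>z. \<Sum>g\<in>G. scm (a g z) (g z))"
    using assms by (auto simp: germ_span_def)
  have "germ_eq K h' (\<lambda>z. \<Sum>g\<in>G. scm (a g z) (g z))"
    unfolding germ_eq_def
  proof
    fix z assume "z \<in> K"
    then have "\<forall>\<^sub>F y in nhds z. h y = (\<Sum>g\<in>G. scm (a g y) (g y))" "\<forall>\<^sub>F y in nhds z. h y = h' y"
      using a(2) assms(2) by (auto simp: germ_eq_def)
    then show "\<forall>\<^sub>F y in nhds z. h' y = (\<Sum>g\<in>G. scm (a g y) (g y))" by eventually_elim simp
  qed
  then show ?thesis using a(1) by (auto simp: germ_span_def)
qed

lemma germ_span_0: "(\<lambda>_. 0) \<in> germ_span sc K (*) G"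
  unfolding germ_span_def by (auto intro!: exI[of _ "\<lambda>_ _. 0"] hol_germs_const germ_eq_refl)

lemma germ_span_add:
  assumes "h \<in> germ_span sc K (*) G" "k \<in> germ_span sc K (*) G"
  shows "(\<lambda>z. h z + k z) \<in> germ_span sc K (*) G"
proof -
  obtain a b where a: "\<forall>g\<in>G. a g \<in> hol_germs sc K" "germ_eq K h (\<lambda>z. \<Sum>g\<in>G. a g z * g z)"
    and b: "\<forall>g\<in>G. b g \<in> hol_germs sc K" "germ_eq K k (\<lambda>z. \<Sum>g\<in>G. b g z * g z)"
    using assms by (auto simp: germ_span_def)
  have "germ_eq K (\<lambda>z. h z + k z) (\<lambda>z. \<Sum>g\<in>G. (a g z + b g z) * g z)"
    unfolding germ_eq_def
  proof
    fix z assume "z \<in> K"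
    then have "\<forall>\<^sub>F y in nhds z. h y = (\<Sum>g\<in>G. a g y * g y)" "\<forall>\<^sub>F y in nhds z. k y = (\<Sum>g\<in>G. b g y * g y)"
      using a(2) b(2) by (auto simp: germ_eq_def)
    then show "\<forall>\<^sub>F y in nhds z. h y + k y = (\<Sum>g\<in>G. (a g y + b g y) * g y)"
      by eventually_elim (simp add: sum.distrib distrib_right)
  qed
  then show ?thesis unfolding germ_span_def
    using a(1) b(1) by (auto intro!: exI[of _ "\<lambda>g z. a g z + b g z"] hol_germs_add)
qed

lemma germ_span_mult:
  assumes "f \<in> hol_germs sc K" "h \<in> germ_span sc K (*) G"
  shows "(\<lambda>z. f z * h z) \<in> germ_span sc K (*) G"
proof -
  obtain a where a: "\<forall>g\<in>G. a g \<in> hol_germs sc K" "germ_eq K h (\<lambda>z. \<Sum>g\<in>G. a g z * g z)"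
    using assms by (auto simp: germ_span_def)
  have "germ_eq K (\<lambda>z. f z * h z) (\<lambda>z. \<Sum>g\<in>G. (f z * a g z) * g z)"
    using a(2) unfolding germ_eq_def
    by (auto elim!: eventually_mono dest!: bspec simp: sum_distrib_left mult.assoc)
  then show ?thesis unfolding germ_span_def
    using a(1) assms(1) by (auto intro!: exI[of _ "\<lambda>g z. f z * a g z"] hol_germs_mult)
qed

lemma germ_span_diff:
  "h \<in> germ_span sc K (*) G \<Longrightarrow> k \<in> germ_span sc K (*) G \<Longrightarrow> (\<lambda>z. h z - k z) \<in> germ_span sc K (*) G"
  using germ_span_add[of h sc K G "\<lambda>z. (- 1) * k z"] germ_span_mult[OF hol_germs_const[of "- 1"], of k] by simp

lemma germ_span_generator:
  assumes "finite G" "g \<in> G"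
  shows "g \<in> germ_span sc K (*) G"
proof -
  have "(\<Sum>k\<in>G. (if k = g then 1 else 0) * k z) = g z" for z
    using assms by (simp add: if_distrib if_distribR cong: if_cong)
  then show ?thesis unfolding germ_span_def
    by (auto intro!: exI[of _ "\<lambda>k _. if k = g then 1 else 0"] hol_germs_const germ_eq_refl simp del: mult_if_delta)
qed

text \<open>
  The function \<open>h\<^sub>i\<close> is the integral of the \<open>i\<close>-th partial derivative over the segment from \<open>(q, s)\<close> to
  \<open>(x, s)\<close>.  Convexity of the ball keeps the segment in the domain, and the fundamental theorem of
  calculus along the segment gives the identity.
\<close>
lemma hadamard_division:
  fixes f :: "(complex^'n) \<times> (complex^'m) \<Rightarrow> complex"
  assumes f: "f \<in> hol_germs scale_xs (cball 0 \<delta> \<times> {0})" and q: "q \<in> cball 0 \<delta>"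
  obtains h where "\<And>i. h i \<in> hol_germs scale_xs (cball 0 \<delta> \<times> {0})"
    "germ_eq (cball 0 \<delta> \<times> {0}) f (\<lambda>z. f (q, snd z) + (\<Sum>i\<in>UNIV. (fst z $ i - q $ i) * h i z))"
proof -
  obtain W where W: "open W" "cball 0 \<delta> \<times> {0} \<subseteq> W" and diff: "\<And>z. z \<in> W \<Longrightarrow> complex_diff_at scale_xs f z"
    using f by (rule hol_germs_open) blast
  have "compact (cball (0 :: complex^'n) \<delta> \<times> {0 :: complex^'m})" by (intro compact_Times compact_cball) simp
  then obtain e where e: "e > 0" "(\<Union>z\<in>cball 0 \<delta> \<times> {0}. ball z e) \<subseteq> W"
    using compact_subset_open_imp_ball_epsilon_subset[OF _ W] by blast
  define B where "B = ball (0 :: complex^'n) (\<delta> + e / 2) \<times> ball (0 :: complex^'m) (e / 2)"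
  have B: "open B" "convex B" "cball 0 \<delta> \<times> {0} \<subseteq> B"
    using e by (auto simp: B_def open_Times convex_Times)
  have "\<delta> \<ge> 0" using q by (simp add: order_trans[OF norm_ge_zero])
  have "B \<subseteq> W"
  proof
    fix z assume z: "z \<in> B"
    obtain y where y: "norm y \<le> \<delta>" "dist y (fst z) < e / 2"
    proof (cases "norm (fst z) \<le> \<delta>")
      case True
      then show ?thesis using that[of "fst z"] e by simp
    next
      case False
      then have pos: "norm (fst z) > 0" using \<open>\<delta> \<ge> 0\<close> by linarith
      let ?y = "(\<delta> / norm (fst z)) *\<^sub>R fst z"
      have "?y - fst z = (\<delta> / norm (fst z) - 1) *\<^sub>R fst z" by (simp add: algebra_simps)
      then have "dist ?y (fst z) = \<bar>\<delta> / norm (fst z) - 1\<bar> * norm (fst z)"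
        by (simp only: dist_norm norm_scaleR)
      also have "\<dots> = norm (fst z) - \<delta>" using False pos by (simp add: abs_if field_simps)
      also have "\<dots> < e / 2" using z by (auto simp: B_def)
      finally show ?thesis using that[of ?y] \<open>\<delta> \<ge> 0\<close> pos by simp
    qed
    have "dist (y, 0) z \<le> dist y (fst z) + dist 0 (snd z)"
      using sqrt_sum_squares_le_sum[of "dist y (fst z)" "dist 0 (snd z)"] by (cases z) (simp add: dist_Pair_Pair)
    also have "\<dots> < e" using y z by (auto simp: B_def)
    finally have "z \<in> ball (y, 0) e" by simp
    then have "z \<in> (\<Union>z\<in>cball 0 \<delta> \<times> {0}. ball z e)" using y(1) by (intro UN_I[of "(y, 0)"]) auto
    then show "z \<in> W" using e(2) by blast
  qed
  then have diffB: "complex_diff_at scale_xs f z" if "z \<in> B" for z using diff that by blast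
  have contf': "continuous_on W (partial_deriv scale_xs v f)" for v
    by (rule xs.continuous_on_partial_deriv[OF W(1)]) (rule diff)
  have diff': "complex_diff_at scale_xs (partial_deriv scale_xs v f) z" if "z \<in> W" for v z
    by (rule xs.complex_diff_at_partial_deriv[OF W(1) _ that]) (rule diff)
  have contf'': "continuous_on W (partial_deriv scale_xs u (partial_deriv scale_xs v f))" for u v
    by (rule xs.continuous_on_partial_deriv[OF W(1)]) (rule diff')
  \<comment> \<open>The point at time \<open>t\<close> of the segment from \<open>(q, s)\<close> to \<open>z = (x, s)\<close> is \<open>a t + L t z\<close>.\<close>
  define a where "a t = ((1 - t) *\<^sub>R q, 0 :: complex^'m)" for t :: real
  define L where "L t z = (t *\<^sub>R fst z, snd z)" for t :: real and z :: "(complex^'n) \<times> (complex^'m)"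
  have L: "bounded_linear (L t)" "L t (scale_xs c z) = scale_xs c (L t z)" for t c z
    unfolding L_def
    by (auto intro!: bounded_linear_Pair bounded_linear_compose[OF bounded_linear_scaleR_right bounded_linear_fst]
        bounded_linear_snd simp: scaleR_vector_scalar_mult)
  have seg: "a t + L t z \<in> B" if "z \<in> B" "t \<in> {0..1}" for z t
  proof -
    have "(q, snd z) \<in> B" using that(1) q e by (auto simp: B_def)
    then have "(1 - t) *\<^sub>R (q, snd z) + t *\<^sub>R z \<in> B"
      by (rule convexD[OF B(2) _ that(1)]) (use that in auto)
    moreover have "(1 - t) *\<^sub>R (q, snd z) + t *\<^sub>R z = a t + L t z"
      by (cases z) (simp add: a_def L_def algebra_simps)
    ultimately show ?thesis by simp
  qed
  have cont_seg: "continuous_on S (\<lambda>x. a (snd x) + L (snd x) (fst x))" for S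
    unfolding a_def L_def by (intro continuous_intros)
  have cont_comp: "continuous_on (B \<times> {0..1}) (\<lambda>x. g (a (snd x) + L (snd x) (fst x)))"
    if "continuous_on W g" for g :: "_ \<Rightarrow> complex"
    by (rule continuous_on_compose2[OF that cont_seg]) (use seg \<open>B \<subseteq> W\<close> in auto)
  have cont_comp1: "continuous_on {0..1} (\<lambda>t. g (a t + L t z))"
    if "continuous_on W g" "z \<in> B" for g :: "_ \<Rightarrow> complex" and z
  proof (rule continuous_on_compose2[OF that(1)])
    show "continuous_on {0..1} (\<lambda>t. a t + L t z)" unfolding a_def L_def by (intro continuous_intros)
    show "(\<lambda>t. a t + L t z) ` {0..1} \<subseteq> W" using seg[OF that(2)] \<open>B \<subseteq> W\<close> by auto
  qed
  define P where "P i = partial_deriv scale_xs (axis i 1, 0) f" for i :: 'n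
  define h where "h i z = integral {0..1} (\<lambda>t. P i (a t + L t z))" for i z
  have h_diff: "complex_diff_at scale_xs (h i) z" if "z \<in> B" for i z
    unfolding h_def
  proof (rule xs.complex_diff_at_integral[OF B(1,2) that])
    show diffP: "complex_diff_at scale_xs (\<lambda>z. P i (a t + L t z)) z" if "z \<in> B" "t \<in> {0..1}" for z t
    proof -
      have "complex_diff_at scale_xs (P i) (a t + L t z)"
        unfolding P_def by (rule diff'[OF subsetD[OF \<open>B \<subseteq> W\<close> seg[OF that]]])
      then show ?thesis by (rule complex_diff_at_affine[where f = "P i"]) (rule L)+
    qed
    show "continuous_on {0..1} (\<lambda>t. P i (a t + L t z))" if "z \<in> B" for z
      unfolding P_def by (rule cont_comp1[OF contf' that])
    show "continuous_on (B \<times> {0..1}) (\<lambda>(z, t). partial_deriv scale_xs v (\<lambda>z. P i (a t + L t z)) z)" for v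
    proof (rule continuous_on_eq)
      show "continuous_on (B \<times> {0..1}) (\<lambda>x.
          of_real (snd x) * partial_deriv scale_xs (fst v, 0) (P i) (a (snd x) + L (snd x) (fst x)) +
          partial_deriv scale_xs (0, snd v) (P i) (a (snd x) + L (snd x) (fst x)))"
        unfolding P_def by (intro continuous_intros cont_comp contf'')
      fix x assume x: "x \<in> B \<times> {0..1::real}"
      let ?z = "fst x" and ?t = "snd x"
      have PW: "complex_diff_at scale_xs (P i) (a ?t + L ?t ?z)"
        unfolding P_def using seg[of ?z ?t] x \<open>B \<subseteq> W\<close> by (intro diff') auto
      have Lv: "L ?t v = ?t *\<^sub>R (fst v, 0) + (0, snd v)" by (simp add: L_def)
      have "partial_deriv scale_xs v (\<lambda>z. P i (a ?t + L ?t z)) ?z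
          = partial_deriv scale_xs (L ?t v) (P i) (a ?t + L ?t ?z)"
        by (rule xs.partial_deriv_affine[OF PW L])
      also have "\<dots> = of_real ?t * partial_deriv scale_xs (fst v, 0) (P i) (a ?t + L ?t ?z) +
          partial_deriv scale_xs (0, snd v) (P i) (a ?t + L ?t ?z)"
        unfolding Lv by (simp only: linear_simps[OF xs.bounded_linear_partial_deriv[OF PW]] scaleR_conv_of_real)
      finally show "of_real (snd x) * partial_deriv scale_xs (fst v, 0) (P i) (a (snd x) + L (snd x) (fst x)) +
          partial_deriv scale_xs (0, snd v) (P i) (a (snd x) + L (snd x) (fst x)) =
          (case x of (z, t) \<Rightarrow> partial_deriv scale_xs v (\<lambda>z. P i (a t + L t z)) z)"
        by (simp only: split_beta)
    qed
  qed
  have taylor: "f z = f (q, snd z) + (\<Sum>i\<in>UNIV. (fst z $ i - q $ i) * h i z)" if z: "z \<in> B" for z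
  proof -
    have der: "((\<lambda>t. f (a t + L t z)) has_vector_derivative
        (\<Sum>i\<in>UNIV. (fst z $ i - q $ i) * P i (a t + L t z))) (at t within {0..1})" if t: "t \<in> {0..1}" for t
    proof -
      let ?y = "a t + L t z" and ?v = "(fst z - q, 0 :: complex^'m)"
      have fd: "complex_diff_at scale_xs f ?y" using diffB seg[OF z t] by blast
      note lin = xs.bounded_linear_partial_deriv[OF fd]
      have "a t' + L t' z = (q, snd z) + t' *\<^sub>R ?v" for t'
        by (cases z) (simp add: a_def L_def algebra_simps)
      then have "((\<lambda>t. a t + L t z) has_derivative (\<lambda>t. t *\<^sub>R ?v)) (at t within {0..1})"
        by (auto intro!: derivative_eq_intros)
      from has_derivative_compose[OF this xs.has_derivative_partial_deriv(1)[OF fd]]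
      have "((\<lambda>t. f (a t + L t z)) has_vector_derivative partial_deriv scale_xs ?v f ?y) (at t within {0..1})"
        unfolding has_vector_derivative_def by (simp only: linear_simps[OF lin])
      moreover have "?v = (\<Sum>i\<in>UNIV. scale_xs (fst z $ i - q $ i) (axis i 1, 0))"
        using basis_expansion[of "fst z - q"] by (simp add: sum_prod)
      then have "partial_deriv scale_xs ?v f ?y =
          (\<Sum>i\<in>UNIV. (fst z $ i - q $ i) * P i ?y)"
        by (simp only: linear_sum[OF bounded_linear.linear[OF lin]] xs.has_derivative_partial_deriv(2)[OF fd] P_def)
      ultimately show ?thesis by simp
    qed
    have "((\<lambda>t. \<Sum>i\<in>UNIV. (fst z $ i - q $ i) * P i (a t + L t z)) has_integral
        (f (a 1 + L 1 z) - f (a 0 + L 0 z))) {0..1}"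
      by (rule fundamental_theorem_of_calculus[OF _ der]) auto
    moreover have "((\<lambda>t. \<Sum>i\<in>UNIV. (fst z $ i - q $ i) * P i (a t + L t z)) has_integral
        (\<Sum>i\<in>UNIV. (fst z $ i - q $ i) * h i z)) {0..1}"
      unfolding h_def P_def
      by (intro has_integral_sum has_integral_mult_right integrable_integral integrable_continuous_interval
          cont_comp1 contf' z) simp
    ultimately have "f (a 1 + L 1 z) - f (a 0 + L 0 z) = (\<Sum>i\<in>UNIV. (fst z $ i - q $ i) * h i z)"
      by (rule has_integral_unique)
    moreover have "a 1 + L 1 z = z" "a 0 + L 0 z = (q, snd z)" by (cases z; simp add: a_def L_def)+
    ultimately show ?thesis by (simp add: algebra_simps)
  qed
  show ?thesis
  proof (rule that)
    show "h i \<in> hol_germs scale_xs (cball 0 \<delta> \<times> {0})" for i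
      by (rule hol_germsI_open[OF B(1) B(3) h_diff])
    show "germ_eq (cball 0 \<delta> \<times> {0}) f (\<lambda>z. f (q, snd z) + (\<Sum>i\<in>UNIV. (fst z $ i - q $ i) * h i z))"
      unfolding germ_eq_def eventually_nhds using B taylor by blast
  qed
qed

section \<open>Coordinates modulo the ideal\<close>

text \<open>
  A family of zero-dimensional schemes over a neighbourhood of 0 in \<open>\<complex>\<^sup>\<mu>\<close>, cut out by finitely many
  equations \<open>G\<close> near the ball: functions \<open>\<phi>\<close> of \<open>x\<close> alone form a basis of its coordinate ring over the
  holomorphic germs of the parameter, with structure constants \<open>w\<close>.
\<close>
locale family_basis =
  fixes \<delta> :: real
    and G :: "((complex^'n) \<times> (complex^'m) \<Rightarrow> complex) set"
    and \<phi> :: "'m \<Rightarrow> complex^'n \<Rightarrow> complex"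
    and w :: "'m \<Rightarrow> 'm \<Rightarrow> 'm \<Rightarrow> complex^'m \<Rightarrow> complex"
  assumes finite_G: "finite G"
    and G_hol: "g \<in> G \<Longrightarrow> g \<in> hol_germs scale_xs (cball 0 \<delta> \<times> {0})"
    and phi_hol: "\<phi> l \<in> hol_germs (*s) (cball 0 \<delta>)"
    and basis: "free_basis_mod \<delta> (germ_span scale_xs (cball 0 \<delta> \<times> {0}) (*) G) \<phi>"
    and w_hol: "w i j l \<in> hol_germs (*s) {0}"
    and w_mult: "(\<lambda>z. \<phi> i (fst z) * \<phi> j (fst z) - (\<Sum>l\<in>UNIV. w i j l (snd z) * \<phi> l (fst z)))
                   \<in> germ_span scale_xs (cball 0 \<delta> \<times> {0}) (*) G"
begin

abbreviation "H \<equiv> hol_germs scale_xs (cball (0 :: complex^'n) \<delta> \<times> {0 :: complex^'m})"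
abbreviation "J \<equiv> germ_span scale_xs (cball 0 \<delta> \<times> {0}) (*) G"
abbreviation "O\<^sub>S \<equiv> hol_germs (*s) {0 :: complex^'m}"

text \<open>
  The germs \<open>a\<close> are coordinates of \<open>h\<close> in the basis \<open>\<phi>\<close> modulo the ideal.
\<close>
definition rep :: "((complex^'n) \<times> (complex^'m) \<Rightarrow> complex) \<Rightarrow> ('m \<Rightarrow> complex^'m \<Rightarrow> complex) \<Rightarrow> bool" where
  "rep h a \<longleftrightarrow> (\<forall>l. a l \<in> O\<^sub>S) \<and> (\<lambda>z. h z - (\<Sum>l\<in>UNIV. a l (snd z) * \<phi> l (fst z))) \<in> J"

lemma rep_hol: "rep h a \<Longrightarrow> a l \<in> O\<^sub>S"
  by (simp add: rep_def)

lemma phi_H: "(\<lambda>z. \<phi> l (fst z)) \<in> H"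
  by (rule hol_germs_fst[OF phi_hol])

lemma rep_exists:
  assumes "h \<in> H"
  obtains a where "rep h a"
  using assms basis unfolding free_basis_mod_def rep_def case_prod_unfold by auto

lemma rep_unique:
  assumes "rep h a" "rep h b"
  shows "\<forall>\<^sub>F s in nhds 0. \<forall>l. a l s = b l s"
proof -
  have "(\<lambda>z. (h z - (\<Sum>l\<in>UNIV. b l (snd z) * \<phi> l (fst z))) - (h z - (\<Sum>l\<in>UNIV. a l (snd z) * \<phi> l (fst z)))) \<in> J"
    using assms germ_span_diff[where h = "\<lambda>z. h z - (\<Sum>l\<in>UNIV. b l (snd z) * \<phi> l (fst z))"
        and k = "\<lambda>z. h z - (\<Sum>l\<in>UNIV. a l (snd z) * \<phi> l (fst z))"] by (simp only: rep_def)
  then have "(\<lambda>(x, s). \<Sum>l\<in>UNIV. (a l s - b l s) * \<phi> l x) \<in> J"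
    by (simp add: case_prod_unfold left_diff_distrib sum_subtractf)
  moreover have "\<forall>l. (\<lambda>s. a l s - b l s) \<in> O\<^sub>S"
    using assms by (auto intro!: hol_germs_diff simp: rep_def)
  ultimately have "\<forall>l. germ_eq {0} (\<lambda>s. a l s - b l s) (\<lambda>_. 0)"
    using basis unfolding free_basis_mod_def by (elim conjE allE[of _ "\<lambda>l s. a l s - b l s"]) auto
  then have "\<forall>l. \<forall>\<^sub>F s in nhds 0. a l s = b l s"
    by (simp add: germ_eq_def)
  then show ?thesis by (simp add: eventually_all_finite)
qed

lemma rep_cong:
  assumes "rep h a" "germ_eq (cball 0 \<delta> \<times> {0}) h k"
  shows "rep k a"
proof -
  have "germ_eq (cball 0 \<delta> \<times> {0}) (\<lambda>z. h z - (\<Sum>l\<in>UNIV. a l (snd z) * \<phi> l (fst z)))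
      (\<lambda>z. k z - (\<Sum>l\<in>UNIV. a l (snd z) * \<phi> l (fst z)))"
    using assms(2) unfolding germ_eq_def by (auto elim!: eventually_mono)
  then show ?thesis using assms(1) germ_span_cong unfolding rep_def by blast
qed

lemma rep_J: "h \<in> J \<Longrightarrow> rep h (\<lambda>_ _. 0)"
  by (simp add: rep_def hol_germs_const)

lemma rep_phi: "rep (\<lambda>z. \<phi> j (fst z)) (\<lambda>l _. if l = j then 1 else 0)"
  unfolding rep_def by (simp add: hol_germs_const germ_span_0 if_distrib[of "\<lambda>c. c * _"] cong: if_cong)

lemma rep_phi_mult: "rep (\<lambda>z. \<phi> i (fst z) * \<phi> j (fst z)) (w i j)"
  using w_mult w_hol by (simp add: rep_def)

lemma rep_add:
  assumes "rep h a" "rep k b"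
  shows "rep (\<lambda>z. h z + k z) (\<lambda>l s. a l s + b l s)"
proof -
  have "(\<lambda>z. (h z - (\<Sum>l\<in>UNIV. a l (snd z) * \<phi> l (fst z))) + (k z - (\<Sum>l\<in>UNIV. b l (snd z) * \<phi> l (fst z)))) \<in> J"
    using assms by (intro germ_span_add) (auto simp: rep_def)
  then show ?thesis
    using assms by (simp add: rep_def hol_germs_add distrib_right sum.distrib algebra_simps)
qed

lemma rep_param_mult:
  assumes "c \<in> O\<^sub>S" "rep h a"
  shows "rep (\<lambda>z. c (snd z) * h z) (\<lambda>l s. c s * a l s)"
proof -
  have "(\<lambda>z. c (snd z) * (h z - (\<Sum>l\<in>UNIV. a l (snd z) * \<phi> l (fst z)))) \<in> J"
    using assms by (intro germ_span_mult hol_germs_snd) (auto simp: rep_def)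
  then show ?thesis
    using assms by (simp add: rep_def hol_germs_mult right_diff_distrib sum_distrib_left mult.assoc)
qed

lemma rep_sum:
  "(\<And>i. i \<in> I \<Longrightarrow> rep (h i) (a i)) \<Longrightarrow> rep (\<lambda>z. \<Sum>i\<in>I. h i z) (\<lambda>l s. \<Sum>i\<in>I. a i l s)"
  by (induction I rule: infinite_finite_induct) (simp_all add: rep_J germ_span_0 rep_add)

lemma rep_diff:
  assumes "rep h a" "rep k b"
  shows "rep (\<lambda>z. h z - k z) (\<lambda>l s. a l s - b l s)"
  using rep_add[OF assms(1) rep_param_mult[OF hol_germs_const[of "- 1"] assms(2)]] by simp

text \<open>
  Reduce first one factor modulo \<open>J\<close>, then the other, and multiply the two combinations of the \<open>\<phi>\<close> by
  means of the structure constants.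
\<close>
lemma rep_mult:
  assumes h: "rep h a" and k: "rep k b" "k \<in> H"
  shows "rep (\<lambda>z. h z * k z) (\<lambda>m s. \<Sum>i\<in>UNIV. \<Sum>j\<in>UNIV. a i s * b j s * w i j m s)"
proof -
  have 1: "rep (\<lambda>z. \<Sum>i\<in>UNIV. \<Sum>j\<in>UNIV. a i (snd z) * b j (snd z) * (\<phi> i (fst z) * \<phi> j (fst z)))
      (\<lambda>m s. \<Sum>i\<in>UNIV. \<Sum>j\<in>UNIV. a i s * b j s * w i j m s)"
    using h k by (intro rep_sum rep_param_mult[of "\<lambda>s. a _ s * b _ s"] hol_germs_mult rep_phi_mult)
      (auto simp: rep_def)
  have "(\<lambda>z. k z * (h z - (\<Sum>i\<in>UNIV. a i (snd z) * \<phi> i (fst z)))) \<in> J"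
    using h k by (intro germ_span_mult) (auto simp: rep_def)
  moreover have "(\<lambda>z. (\<Sum>i\<in>UNIV. a i (snd z) * \<phi> i (fst z)) * (k z - (\<Sum>j\<in>UNIV. b j (snd z) * \<phi> j (fst z)))) \<in> J"
    using h k by (intro germ_span_mult hol_germs_sum hol_germs_mult hol_germs_snd phi_H) (auto simp: rep_def)
  ultimately have "rep (\<lambda>z. k z * (h z - (\<Sum>i\<in>UNIV. a i (snd z) * \<phi> i (fst z))) +
      (\<Sum>i\<in>UNIV. a i (snd z) * \<phi> i (fst z)) * (k z - (\<Sum>j\<in>UNIV. b j (snd z) * \<phi> j (fst z)))) (\<lambda>_ _. 0)"
    by (intro rep_J germ_span_add)
  from rep_add[OF this 1]
  have "rep (\<lambda>z. k z * (h z - (\<Sum>i\<in>UNIV. a i (snd z) * \<phi> i (fst z))) +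
      (\<Sum>i\<in>UNIV. a i (snd z) * \<phi> i (fst z)) * (k z - (\<Sum>j\<in>UNIV. b j (snd z) * \<phi> j (fst z))) +
      (\<Sum>i\<in>UNIV. \<Sum>j\<in>UNIV. a i (snd z) * b j (snd z) * (\<phi> i (fst z) * \<phi> j (fst z))))
      (\<lambda>m s. \<Sum>i\<in>UNIV. \<Sum>j\<in>UNIV. a i s * b j s * w i j m s)" by simp
  moreover have "(\<Sum>i\<in>UNIV. \<Sum>j\<in>UNIV. a i (snd z) * b j (snd z) * (\<phi> i (fst z) * \<phi> j (fst z))) =
      (\<Sum>i\<in>UNIV. a i (snd z) * \<phi> i (fst z)) * (\<Sum>j\<in>UNIV. b j (snd z) * \<phi> j (fst z))" for z
    by (simp add: sum_product mult_ac)
  ultimately show ?thesis by (simp add: algebra_simps)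
qed

section \<open>The fibre algebras\<close>

lemma eventually_unit:
  assumes "rep (\<lambda>_. 1) u"
  shows "\<forall>\<^sub>F s in nhds 0. \<forall>j m. (\<Sum>l\<in>UNIV. u l s * w l j m s) = (if j = m then 1 else 0)"
proof -
  have "\<forall>\<^sub>F s in nhds 0. \<forall>m. (\<Sum>l\<in>UNIV. u l s * w l j m s) = (if j = m then 1 else 0)" for j
  proof -
    have "rep (\<lambda>z. \<phi> j (fst z)) (\<lambda>m s. \<Sum>l\<in>UNIV. \<Sum>i\<in>UNIV. u l s * (if i = j then 1 else 0) * w l i m s)"
      using rep_mult[OF assms rep_phi phi_H, of j] by simp
    then have "\<forall>\<^sub>F s in nhds 0. \<forall>m. (\<Sum>l\<in>UNIV. \<Sum>i\<in>UNIV. u l s * (if i = j then 1 else 0) * w l i m s) = (if m = j then 1 else 0)"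
      using rep_phi by (rule rep_unique)
    then show ?thesis
      by (simp add: if_distrib[of "\<lambda>c. _ * c"] if_distrib[of "\<lambda>c. c * _"] eq_commute[of j] cong: if_cong)
  qed
  then show ?thesis by (simp add: eventually_all_finite)
qed

text \<open>
  Each law of the fibre algebras compares two ways to write one germ in the basis \<open>\<phi>\<close>.  By uniqueness
  of coordinates the two sides agree near 0, and there are finitely many laws to consider.
\<close>
lemma eventually_commutative_algebra:
  "\<forall>\<^sub>F s in nhds 0. \<exists>u. commutative_algebra_constants (\<lambda>i j l. w i j l s) u"
proof -
  obtain u where u: "rep (\<lambda>_. 1) u" using rep_exists[OF hol_germs_const] by blast
  have comm: "\<forall>\<^sub>F s in nhds 0. \<forall>i j l. w i j l s = w j i l s"
  proof -
    have "\<forall>\<^sub>F s in nhds 0. \<forall>l. w i j l s = w j i l s" for i j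
      using rep_phi_mult[of i j] rep_phi_mult[of j i] by (intro rep_unique) (simp_all add: mult.commute)
    then show ?thesis by (simp add: eventually_all_finite)
  qed
  have assoc: "\<forall>\<^sub>F s in nhds 0. \<forall>i j k m. (\<Sum>l\<in>UNIV. w i j l s * w l k m s) = (\<Sum>l\<in>UNIV. w j k l s * w i l m s)"
  proof -
    have "\<forall>\<^sub>F s in nhds 0. \<forall>m. (\<Sum>l\<in>UNIV. w i j l s * w l k m s) = (\<Sum>l\<in>UNIV. w j k l s * w i l m s)" for i j k
    proof -
      have "rep (\<lambda>z. \<phi> i (fst z) * \<phi> j (fst z) * \<phi> k (fst z))
          (\<lambda>m s. \<Sum>l\<in>UNIV. \<Sum>n\<in>UNIV. w i j l s * (if n = k then 1 else 0) * w l n m s)"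
        by (rule rep_mult[OF rep_phi_mult rep_phi phi_H])
      moreover have "rep (\<lambda>z. \<phi> i (fst z) * (\<phi> j (fst z) * \<phi> k (fst z)))
          (\<lambda>m s. \<Sum>l\<in>UNIV. \<Sum>n\<in>UNIV. (if l = i then 1 else 0) * w j k n s * w l n m s)"
        by (rule rep_mult[OF rep_phi rep_phi_mult hol_germs_mult[OF phi_H phi_H]])
      ultimately have "\<forall>\<^sub>F s in nhds 0. \<forall>m. (\<Sum>l\<in>UNIV. \<Sum>n\<in>UNIV. w i j l s * (if n = k then 1 else 0) * w l n m s) =
          (\<Sum>l\<in>UNIV. \<Sum>n\<in>UNIV. (if l = i then 1 else 0) * w j k n s * w l n m s)"
        by (intro rep_unique) (simp_all add: mult.assoc)
      moreover have "(\<Sum>l\<in>UNIV. \<Sum>n\<in>UNIV. w i j l s * (if n = k then 1 else 0) * w l n m s) = (\<Sum>l\<in>UNIV. w i j l s * w l k m s)" for m s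
        by (simp add: if_distrib[of "\<lambda>c. _ * c"] if_distrib[of "\<lambda>c. c * _"] cong: if_cong)
      moreover have "(\<Sum>l\<in>UNIV. \<Sum>n\<in>UNIV. (if l = i then 1 else 0) * w j k n s * w l n m s) = (\<Sum>l\<in>UNIV. w j k l s * w i l m s)" for m s
        by (subst sum.swap) (simp add: if_distrib[of "\<lambda>c. _ * c"] if_distrib[of "\<lambda>c. c * _"] cong: if_cong)
      ultimately show ?thesis by simp
    qed
    then show ?thesis by (simp add: eventually_all_finite)
  qed
  show ?thesis using comm assoc eventually_unit[OF u]
  proof eventually_elim
    case (elim s)
    then have "commutative_algebra_constants (\<lambda>i j l. w i j l s) (\<lambda>l. u l s)"
      by (intro commutative_algebra_constants.intro) blast+
    then show ?case by blast
  qed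
qed

text \<open>
  An element of the ideal equals \<open>\<Sum> a\<^sub>g g\<close> only near the central slice, but by compactness of the ball
  this covers all its points for small parameters.
\<close>
lemma J_eventually_vanishes:
  assumes "h \<in> J"
  shows "\<forall>\<^sub>F s in nhds 0. \<forall>p\<in>cball 0 \<delta>. (\<forall>g\<in>G. g (p, s) = 0) \<longrightarrow> h (p, s) = 0"
proof -
  obtain a where "germ_eq (cball 0 \<delta> \<times> {0}) h (\<lambda>z. \<Sum>g\<in>G. a g z * g z)"
    using assms by (auto simp: germ_span_def)
  then have "\<forall>\<^sub>F s in nhds 0. \<forall>p\<in>cball 0 \<delta>. h (p, s) = (\<Sum>g\<in>G. a g (p, s) * g (p, s))"
    by (intro eventually_nhds_compact_slice compact_cball) (auto simp: germ_eq_def)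
  then show ?thesis by eventually_elim (auto intro!: sum.neutral)
qed

lemma rep_eventually_eq:
  assumes "rep h a"
  shows "\<forall>\<^sub>F s in nhds 0. \<forall>p\<in>cball 0 \<delta>. (\<forall>g\<in>G. g (p, s) = 0) \<longrightarrow> h (p, s) = (\<Sum>l\<in>UNIV. a l s * \<phi> l p)"
  using J_eventually_vanishes[of "\<lambda>z. h z - (\<Sum>l\<in>UNIV. a l (snd z) * \<phi> l (fst z))"] assms
  by (simp add: rep_def)

abbreviation character :: "complex^'m \<Rightarrow> complex^'m \<Rightarrow> bool" where
  "character s \<equiv> algebra_character (\<lambda>i j l. w i j l s)"

abbreviation point_character :: "complex^'n \<Rightarrow> complex^'m" where
  "point_character p \<equiv> \<chi> l. \<phi> l p"

text \<open>
  At a common zero of the equations the multiplication table of the \<open>\<phi>\<close> modulo \<open>J\<close> becomes an equality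
  of numbers.  The values do not all vanish, since 1 is a combination of the \<open>\<phi>\<close> modulo \<open>J\<close>.
\<close>
lemma eventually_point_character:
  "\<forall>\<^sub>F s in nhds 0. \<forall>p\<in>cball 0 \<delta>. (\<forall>g\<in>G. g (p, s) = 0) \<longrightarrow> character s (point_character p)"
proof -
  obtain u where u: "rep (\<lambda>_. 1) u" using rep_exists[OF hol_germs_const] by blast
  have "\<forall>\<^sub>F s in nhds 0. \<forall>i j. \<forall>p\<in>cball 0 \<delta>. (\<forall>g\<in>G. g (p, s) = 0) \<longrightarrow> \<phi> i p * \<phi> j p = (\<Sum>l\<in>UNIV. w i j l s * \<phi> l p)"
    using rep_eventually_eq[OF rep_phi_mult] by (simp add: eventually_all_finite)
  then show ?thesis using rep_eventually_eq[OF u]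
  proof eventually_elim
    case (elim s)
    show ?case
    proof (intro ballI impI)
      fix p assume p: "p \<in> cball 0 \<delta>" "\<forall>g\<in>G. g (p, s) = 0"
      have "(\<Sum>l\<in>UNIV. u l s * \<phi> l p) = 1" using elim(2) p by auto
      then have "\<exists>l. \<phi> l p \<noteq> 0" by (metis (no_types, lifting) mult_zero_right sum.neutral zero_neq_one)
      then show "character s (point_character p)"
        using elim(1) p by (simp add: algebra_character_def vec_eq_iff)
    qed
  qed
qed

text \<open>
  The coordinate functions are combinations of the \<open>\<phi>\<close> modulo \<open>J\<close>, so the values of the \<open>\<phi>\<close> at a zero
  determine the zero.
\<close>
lemma eventually_point_character_inj:
  "\<forall>\<^sub>F s in nhds 0. inj_on point_character {p\<in>cball 0 \<delta>. \<forall>g\<in>G. g (p, s) = 0}"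
proof -
  have "\<exists>a. rep (\<lambda>z. fst z $ i) a" for i using rep_exists[OF hol_germs_coordinate] by blast
  then obtain a where a: "\<And>i. rep (\<lambda>z. fst z $ i) (a i)" by metis
  have "\<forall>\<^sub>F s in nhds 0. \<forall>i. \<forall>p\<in>cball 0 \<delta>. (\<forall>g\<in>G. g (p, s) = 0) \<longrightarrow> p $ i = (\<Sum>l\<in>UNIV. a i l s * \<phi> l p)"
    using rep_eventually_eq[OF a] by (simp add: eventually_all_finite)
  then show ?thesis
  proof eventually_elim
    case (elim s)
    show ?case
    proof (rule inj_onI)
      fix p p' assume *: "p \<in> {p\<in>cball 0 \<delta>. \<forall>g\<in>G. g (p, s) = 0}" "p' \<in> {p\<in>cball 0 \<delta>. \<forall>g\<in>G. g (p, s) = 0}"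
        and "point_character p = point_character p'"
      then have "\<phi> l p = \<phi> l p'" for l by (simp add: vec_eq_iff)
      then show "p = p'" using elim * by (simp add: vec_eq_iff)
    qed
  qed
qed

section \<open>Characters of the fibre algebras are points\<close>

text \<open>
  The value of the functional \<open>\<psi>\<close> on the fibre at \<open>s\<close> at the element with coordinates \<open>a\<close>.
\<close>
definition ev :: "('m \<Rightarrow> complex^'m \<Rightarrow> complex) \<Rightarrow> complex^'m \<Rightarrow> complex^'m \<Rightarrow> complex" where
  "ev a s \<psi> = (\<Sum>l\<in>UNIV. a l s * \<psi> $ l)"

lemma ev_add: "ev (\<lambda>l s. a l s + b l s) s \<psi> = ev a s \<psi> + ev b s \<psi>"
  by (simp add: ev_def distrib_right sum.distrib)

lemma ev_diff: "ev (\<lambda>l s. a l s - b l s) s \<psi> = ev a s \<psi> - ev b s \<psi>"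
  by (simp add: ev_def left_diff_distrib sum_subtractf)

lemma ev_param_mult: "ev (\<lambda>l s. c s * a l s) s \<psi> = c s * ev a s \<psi>"
  by (simp add: ev_def sum_distrib_left mult.assoc)

lemma ev_sum: "ev (\<lambda>l s. \<Sum>i\<in>I. a i l s) s \<psi> = (\<Sum>i\<in>I. ev (a i) s \<psi>)"
  by (simp add: ev_def sum_distrib_right) (rule sum.swap)

lemma ev_mult:
  assumes "character s \<psi>"
  shows "ev (\<lambda>m s. \<Sum>i\<in>UNIV. \<Sum>j\<in>UNIV. a i s * b j s * w i j m s) s \<psi> = ev a s \<psi> * ev b s \<psi>"
proof -
  have "ev (\<lambda>m s. \<Sum>i\<in>UNIV. \<Sum>j\<in>UNIV. a i s * b j s * w i j m s) s \<psi> =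
      (\<Sum>i\<in>UNIV. \<Sum>j\<in>UNIV. a i s * b j s * (\<Sum>m\<in>UNIV. w i j m s * \<psi> $ m))"
    unfolding ev_sum by (simp add: ev_def sum_distrib_left mult.assoc)
  also have "\<dots> = (\<Sum>i\<in>UNIV. \<Sum>j\<in>UNIV. a i s * \<psi> $ i * (b j s * \<psi> $ j))"
    unfolding assms[unfolded algebra_character_def, THEN conjunct2, rule_format, symmetric] by (simp only: mult_ac)
  finally show ?thesis by (simp add: ev_def sum_product)
qed

lemma rep_unique_ev:
  assumes "rep h a" "rep h b"
  shows "\<forall>\<^sub>F s in nhds 0. \<forall>\<psi>. ev a s \<psi> = ev b s \<psi>"
  using rep_unique[OF assms] by eventually_elim (simp add: ev_def)

lemma eventually_ev_one:
  assumes u: "rep (\<lambda>_. 1) u"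
  shows "\<forall>\<^sub>F s in nhds 0. \<forall>\<psi>. character s \<psi> \<longrightarrow> ev u s \<psi> = 1"
  using eventually_unit[OF u]
proof eventually_elim
  case (elim s)
  show ?case
  proof (intro allI impI)
    fix \<psi> assume ch: "character s \<psi>"
    then obtain j where j: "\<psi> $ j \<noteq> 0" by (auto simp: algebra_character_def vec_eq_iff)
    have "ev u s \<psi> * \<psi> $ j = (\<Sum>l\<in>UNIV. u l s * (\<psi> $ l * \<psi> $ j))"
      by (simp add: ev_def sum_distrib_right mult.assoc)
    also have "\<dots> = (\<Sum>l\<in>UNIV. u l s * (\<Sum>m\<in>UNIV. w l j m s * \<psi> $ m))"
      using ch by (simp add: algebra_character_def)
    also have "\<dots> = (\<Sum>m\<in>UNIV. (\<Sum>l\<in>UNIV. u l s * w l j m s) * \<psi> $ m)"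
      by (simp add: sum_distrib_left sum_distrib_right mult.assoc) (rule sum.swap)
    also have "\<dots> = \<psi> $ j"
      using elim by (simp add: if_distrib[of "\<lambda>c. c * _"] cong: if_cong)
    finally show "ev u s \<psi> = 1" using j by simp
  qed
qed

lemma tendsto_ev:
  assumes "rep h a"
  shows "((\<lambda>z. ev a (snd z) (fst z)) \<longlongrightarrow> ev a 0 \<theta>) (nhds (\<theta>, 0))"
proof -
  have "isCont (\<lambda>z. ev a (snd z) (fst z)) (\<theta>, 0)"
    unfolding ev_def
    by (intro continuous_intros isCont_o2[where f = snd and g = "a _"])
      (auto intro!: hol_germs_isCont[OF rep_hol[OF assms]])
  from isCont_tendsto_nhds[OF this] show ?thesis by simp
qed

lemma eventually_nhds_snd:
  "\<forall>\<^sub>F s in nhds (0 :: complex^'m). P s \<Longrightarrow> \<forall>\<^sub>F z in nhds (\<theta> :: complex^'m, 0). P (snd z)"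
proof (erule eventually_compose_filterlim)
  have "isCont snd (\<theta>, 0 :: complex^'m)" by (intro continuous_intros)
  from isCont_tendsto_nhds[OF this] show "filterlim snd (nhds 0) (nhds (\<theta>, 0 :: complex^'m))" by simp
qed

text \<open>
  A choice of coordinates for the function \<open>x\<^sub>i\<close>, fixed once so that the smallness conditions on the
  parameter refer to the same germs throughout.
\<close>
definition coord :: "'n \<Rightarrow> 'm \<Rightarrow> complex^'m \<Rightarrow> complex" where
  "coord i = (SOME a. rep (\<lambda>z. fst z $ i) a)"

lemma rep_coord: "rep (\<lambda>z. fst z $ i) (coord i)"
proof -
  have "\<exists>a. rep (\<lambda>z. fst z $ i) a" using rep_exists[OF hol_germs_coordinate] by blast
  then show ?thesis unfolding coord_def by (rule someI_ex)
qed

text \<open>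
  The point at which a character \<open>fst z\<close> of the fibre at \<open>snd z\<close> must be the evaluation, if there is one.
  It is defined by the same formula for vectors that are not characters, which makes it continuous.
\<close>
definition character_point :: "(complex^'m) \<times> (complex^'m) \<Rightarrow> complex^'n" where
  "character_point z = (\<chi> i. ev (coord i) (snd z) (fst z))"

lemma tendsto_character_point: "(character_point \<longlongrightarrow> character_point (\<theta>, 0)) (nhds (\<theta>, 0))"
  unfolding character_point_def by (intro tendsto_vec_lambda) (auto intro: tendsto_ev[OF rep_coord])

lemma tendsto_character_point_pair: "((\<lambda>z. (character_point z, snd z)) \<longlongrightarrow> (character_point (\<theta>, 0), 0)) (nhds (\<theta>, 0))"
proof -
  have "isCont snd (\<theta>, 0 :: complex^'m)" by (intro continuous_intros)
  from isCont_tendsto_nhds[OF this] have "(snd \<longlongrightarrow> (0 :: complex^'m)) (nhds (\<theta>, 0))" by simp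
  then show ?thesis by (intro tendsto_Pair tendsto_character_point)
qed

text \<open>
  If \<open>q\<close> were outside the ball, then by the Cauchy-Schwarz inequality the affine function
  \<open>\<Sum>\<^sub>i cnj q\<^sub>i x\<^sub>i - \<bar>q\<bar>\<^sup>2\<close> would not vanish on the ball.  It would be a unit near the ball, although the
  character maps it to its value 0 at \<open>q\<close>.
\<close>
lemma character_point_in_cball:
  assumes ch: "character 0 \<theta>"
  shows "character_point (\<theta>, 0) \<in> cball 0 \<delta>"
proof (rule ccontr)
  define q where "q = character_point (\<theta>, 0)"
  define f :: "(complex^'n) \<times> (complex^'m) \<Rightarrow> complex"
    where "f z = (\<Sum>i\<in>UNIV. cnj (q $ i) * fst z $ i) - (\<Sum>i\<in>UNIV. cnj (q $ i) * q $ i) * 1" for z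
  assume "character_point (\<theta>, 0) \<notin> cball 0 \<delta>"
  then have far: "norm q > \<delta>" by (simp add: q_def)
  obtain u where u: "rep (\<lambda>_. 1) u" using rep_exists[OF hol_germs_const] by blast
  define a where "a = (\<lambda>l s. (\<Sum>i\<in>UNIV. cnj (q $ i) * coord i l s) - (\<Sum>i\<in>UNIV. cnj (q $ i) * q $ i) * u l s)"
  have f_rep: "rep f a"
    unfolding f_def a_def
    by (intro rep_diff rep_sum rep_param_mult[where c = "\<lambda>_. cnj (q $ _)"] rep_coord u hol_germs_const
        rep_param_mult[where c = "\<lambda>_. \<Sum>i\<in>UNIV. cnj (q $ i) * q $ i"])
  have f_H: "f \<in> H"
    unfolding f_def by (intro hol_germs_intros hol_germs_coordinate)
  have nz: "f z \<noteq> 0" if "z \<in> cball 0 \<delta> \<times> {0}" for z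
  proof
    assume "f z = 0"
    moreover have qq: "(\<Sum>i\<in>UNIV. cnj (q $ i) * q $ i) = of_real ((norm q)\<^sup>2)"
    proof -
      have "of_real ((norm q)\<^sup>2) = (\<Sum>i\<in>UNIV. of_real ((norm (q $ i))\<^sup>2) :: complex)"
        by (simp add: norm_vec_def L2_set_def sum_nonneg)
      then show ?thesis by (simp only: complex_norm_square) (simp only: mult.commute)
    qed
    ultimately have "of_real ((norm q)\<^sup>2) = (\<Sum>i\<in>UNIV. cnj (q $ i) * fst z $ i)"
      by (simp add: f_def)
    then have "(norm q)\<^sup>2 = norm (\<Sum>i\<in>UNIV. cnj (q $ i) * fst z $ i)"
      by (metis norm_of_real abs_of_nonneg zero_le_power2)
    also have "\<dots> \<le> (\<Sum>i\<in>UNIV. norm (q $ i) * norm (fst z $ i))"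
      by (rule order_trans[OF norm_sum]) (simp add: norm_mult)
    also have "\<dots> \<le> norm q * norm (fst z)"
      unfolding norm_vec_def using L2_set_mult_ineq[of "\<lambda>i. norm (q $ i)" "\<lambda>i. norm (fst z $ i)" UNIV] by simp
    also have "\<dots> \<le> norm q * \<delta>" using that by (intro mult_left_mono) auto
    also have "\<dots> < norm q * norm q"
      using far that by (intro mult_strict_left_mono) (auto intro: le_less_trans[OF order_trans[OF norm_ge_zero]])
    finally show False by (simp add: power2_eq_square)
  qed
  have inv_H: "(\<lambda>z. inverse (f z)) \<in> H" by (rule hol_germs_inverse[OF f_H nz])
  then obtain b where b: "rep (\<lambda>z. inverse (f z)) b" using rep_exists by blast
  have "germ_eq (cball 0 \<delta> \<times> {0}) (\<lambda>z. f z * inverse (f z)) (\<lambda>_. 1)"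
    unfolding germ_eq_def
  proof
    fix z assume z: "z \<in> cball (0 :: complex^'n) \<delta> \<times> {0 :: complex^'m}"
    have "\<forall>\<^sub>F y in nhds z. f y \<noteq> 0"
      using hol_germs_isCont[OF f_H z] nz[OF z]
      by (metis isCont_def tendsto_at_iff_tendsto_nhds tendsto_imp_eventually_ne)
    then show "\<forall>\<^sub>F y in nhds z. f y * inverse (f y) = 1" by eventually_elim simp
  qed
  from eventually_nhds_x_imp_x[OF rep_unique_ev[OF rep_cong[OF rep_mult[OF f_rep b inv_H] this] u]]
  have "ev a 0 \<theta> * ev b 0 \<theta> = ev u 0 \<theta>"
    by (intro trans[OF ev_mult[OF ch, symmetric]]) (rule spec)
  moreover have u1: "ev u 0 \<theta> = 1"
    using eventually_nhds_x_imp_x[OF eventually_ev_one[OF u]] ch by simp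
  moreover have "ev a 0 \<theta> = (\<Sum>i\<in>UNIV. cnj (q $ i) * ev (coord i) 0 \<theta>) - (\<Sum>i\<in>UNIV. cnj (q $ i) * q $ i)"
    using ev_param_mult[of "\<lambda>_. cnj (q $ _)"] ev_param_mult[of "\<lambda>_. \<Sum>i\<in>UNIV. cnj (q $ i) * q $ i" u]
    by (simp add: a_def ev_diff ev_sum u1)
  moreover have "ev (coord i) 0 \<theta> = q $ i" for i by (simp add: q_def character_point_def)
  ultimately show False by simp
qed

text \<open>
  How far the vector \<open>fst z\<close> is from being the evaluation at its point, and that point from being a zero
  of the equations.
\<close>
definition defect :: "(complex^'m) \<times> (complex^'m) \<Rightarrow> real" where
  "defect z = (\<Sum>l\<in>UNIV. norm (fst z $ l - \<phi> l (character_point z))) + (\<Sum>g\<in>G. norm (g (character_point z, snd z)))"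

text \<open>
  Write \<open>h = h(q, s) + \<Sum>\<^sub>i (x\<^sub>i - q\<^sub>i) k\<^sub>i\<close> by Hadamard's lemma, where \<open>q\<close> is the point of \<open>\<theta>\<close>.  Applying a
  character and evaluating at its point \<open>p\<close> both turn \<open>x\<^sub>i\<close> into \<open>p\<^sub>i\<close>, so the difference of the results is
  \<open>\<Sum>\<^sub>i (p\<^sub>i - q\<^sub>i) D(k\<^sub>i)\<close> with \<open>D(k\<^sub>i)\<close> the corresponding difference for \<open>k\<^sub>i\<close>.  Expanding \<open>k\<^sub>i\<close> in the \<open>\<phi>\<close>
  and the equations bounds \<open>D(k\<^sub>i)\<close> by a bounded multiple of the defect, while \<open>p\<^sub>i - q\<^sub>i\<close> tends to 0.
\<close>
lemma discrepancy_le_defect: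
  assumes h: "rep h a" "h \<in> H" and ch: "character 0 \<theta>"
  obtains \<kappa> where "(\<kappa> \<longlongrightarrow> 0) (nhds (\<theta>, 0))"
    "\<forall>\<^sub>F z in nhds (\<theta>, 0). character (snd z) (fst z) \<longrightarrow>
       norm (ev a (snd z) (fst z) - h (character_point z, snd z)) \<le> \<kappa> z * defect z"
proof -
  define q where "q = character_point (\<theta>, 0)"
  have q: "q \<in> cball 0 \<delta>" unfolding q_def by (rule character_point_in_cball[OF ch])
  obtain u where u: "rep (\<lambda>_. 1) u" using rep_exists[OF hol_germs_const] by blast
  obtain k where k: "\<And>i. k i \<in> H"
    and div: "germ_eq (cball 0 \<delta> \<times> {0}) h (\<lambda>z. h (q, snd z) + (\<Sum>i\<in>UNIV. (fst z $ i - q $ i) * k i z))"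
    using hadamard_division[OF h(2) q] by blast
  have "\<exists>a. rep (k i) a" for i using rep_exists[OF k] by blast
  then obtain c where c: "\<And>i. rep (k i) (c i)" by metis
  have "\<forall>i. \<exists>b. (\<forall>g\<in>G. b g \<in> H) \<and> germ_eq (cball 0 \<delta> \<times> {0})
      (\<lambda>z. k i z - (\<Sum>l\<in>UNIV. c i l (snd z) * \<phi> l (fst z))) (\<lambda>z. \<Sum>g\<in>G. b g z * g z)"
    using c by (auto simp: rep_def germ_span_def)
  from choice[OF this] obtain b where "\<forall>i. (\<forall>g\<in>G. b i g \<in> H) \<and> germ_eq (cball 0 \<delta> \<times> {0})
      (\<lambda>z. k i z - (\<Sum>l\<in>UNIV. c i l (snd z) * \<phi> l (fst z))) (\<lambda>z. \<Sum>g\<in>G. b i g z * g z)" ..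
  then have b: "\<And>i g. g \<in> G \<Longrightarrow> b i g \<in> H"
    and kb: "\<And>i. germ_eq (cball 0 \<delta> \<times> {0})
      (\<lambda>z. k i z - (\<Sum>l\<in>UNIV. c i l (snd z) * \<phi> l (fst z))) (\<lambda>z. \<Sum>g\<in>G. b i g z * g z)" by simp_all
  have q0: "(q, 0) \<in> cball 0 \<delta> \<times> {0 :: complex^'m}" using q by simp
  note pull = eventually_compose_filterlim[OF _ tendsto_character_point_pair[of \<theta>, folded q_def]]
  have h_at: "\<forall>\<^sub>F z in nhds (\<theta>, 0). h (character_point z, snd z) =
      h (q, snd z) + (\<Sum>i\<in>UNIV. (character_point z $ i - q $ i) * k i (character_point z, snd z))"
    using pull[OF div[unfolded germ_eq_def, rule_format, OF q0]] by simp
  have k_at: "\<forall>\<^sub>F z in nhds (\<theta>, 0). \<forall>i. k i (character_point z, snd z) - (\<Sum>l\<in>UNIV. c i l (snd z) * \<phi> l (character_point z)) =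
      (\<Sum>g\<in>G. b i g (character_point z, snd z) * g (character_point z, snd z))"
    using pull[OF kb[unfolded germ_eq_def, rule_format, OF q0]] by (simp add: eventually_all_finite)
  \<comment> \<open>Coordinates of the Hadamard expansion, computed from those of the coordinate functions.\<close>
  define a' where "a' = (\<lambda>m s. h (q, s) * u m s +
      (\<Sum>i\<in>UNIV. \<Sum>j\<in>UNIV. \<Sum>l\<in>UNIV. (coord i j s - q $ i * u j s) * c i l s * w j l m s))"
  have "rep (\<lambda>z. h (q, snd z) * 1 + (\<Sum>i\<in>UNIV. (fst z $ i - q $ i * 1) * k i z)) a'"
    unfolding a'_def
    by (intro rep_add rep_sum rep_param_mult[OF hol_germs_slice[OF h(2) q]] u rep_mult rep_diff rep_coord c k
        rep_param_mult[where c = "\<lambda>_. q $ _"] hol_germs_const)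
  then have "rep h a'"
  proof (rule rep_cong)
    show "germ_eq (cball 0 \<delta> \<times> {0}) (\<lambda>z. h (q, snd z) * 1 + (\<Sum>i\<in>UNIV. (fst z $ i - q $ i * 1) * k i z)) h"
      using div unfolding germ_eq_def by (auto elim!: eventually_mono)
  qed
  note eventually_nhds_snd[OF rep_unique_ev[OF h(1) this], of \<theta>]
  moreover note eventually_nhds_snd[OF eventually_ev_one[OF u], of \<theta>]
  ultimately have ev_at: "\<forall>\<^sub>F z in nhds (\<theta>, 0). character (snd z) (fst z) \<longrightarrow>
      ev a (snd z) (fst z) = h (q, snd z) + (\<Sum>i\<in>UNIV. (character_point z $ i - q $ i) * ev (c i) (snd z) (fst z))"
  proof eventually_elim
    case (elim z)
    show ?case
    proof
      assume chz: "character (snd z) (fst z)"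
      have "ev a' (snd z) (fst z) = h (q, snd z) * ev u (snd z) (fst z) +
          (\<Sum>i\<in>UNIV. (ev (coord i) (snd z) (fst z) - q $ i * ev u (snd z) (fst z)) * ev (c i) (snd z) (fst z))"
      proof -
        have "ev a' (snd z) (fst z) = h (q, snd z) * ev u (snd z) (fst z) + (\<Sum>i\<in>UNIV.
            ev (\<lambda>m s. \<Sum>j\<in>UNIV. \<Sum>l\<in>UNIV. (coord i j s - q $ i * u j s) * c i l s * w j l m s) (snd z) (fst z))"
          unfolding a'_def ev_add ev_param_mult by (subst ev_sum) (rule refl)
        also have "\<dots> = h (q, snd z) * ev u (snd z) (fst z) +
            (\<Sum>i\<in>UNIV. ev (\<lambda>j s. coord i j s - q $ i * u j s) (snd z) (fst z) * ev (c i) (snd z) (fst z))"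
          by (intro arg_cong2[of _ _ _ _ "(+)"] sum.cong refl ev_mult[OF chz])
        finally show ?thesis using ev_param_mult[of "\<lambda>_. q $ _" u] by (simp add: ev_diff)
      qed
      then show "ev a (snd z) (fst z) = h (q, snd z) + (\<Sum>i\<in>UNIV. (character_point z $ i - q $ i) * ev (c i) (snd z) (fst z))"
        using elim chz by (simp add: character_point_def)
    qed
  qed
  define \<kappa> where "\<kappa> z = (\<Sum>i\<in>UNIV. norm (character_point z $ i - q $ i) *
      ((\<Sum>l\<in>UNIV. norm (c i l (snd z))) + (\<Sum>g\<in>G. norm (b i g (character_point z, snd z)))))" for z
  have "(\<kappa> \<longlongrightarrow> (\<Sum>i\<in>UNIV. norm (q $ i - q $ i) *
      ((\<Sum>l\<in>UNIV. norm (c i l 0)) + (\<Sum>g\<in>G. norm (b i g (q, 0)))))) (nhds (\<theta>, 0))"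
  proof -
    have 1: "((\<lambda>z. c i l (snd z)) \<longlongrightarrow> c i l 0) (nhds (\<theta>, 0))" for i l
    proof -
      have "isCont (c i l) (snd (q, 0))" using hol_germs_isCont[OF rep_hol[OF c]] by simp
      from isCont_tendsto_compose[OF this tendsto_snd[OF tendsto_character_point_pair[of \<theta>, folded q_def]]] show ?thesis by simp
    qed
    have 2: "((\<lambda>z. b i g (character_point z, snd z)) \<longlongrightarrow> b i g (q, 0)) (nhds (\<theta>, 0))" if "g \<in> G" for i g
      by (rule isCont_tendsto_compose[OF hol_germs_isCont[OF b[OF that] q0] tendsto_character_point_pair[of \<theta>, folded q_def]])
    have 3: "((\<lambda>z. character_point z $ i) \<longlongrightarrow> q $ i) (nhds (\<theta>, 0))" for i
      unfolding q_def by (rule tendsto_vec_nth[OF tendsto_character_point])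
    show ?thesis unfolding \<kappa>_def by (intro tendsto_intros 1 2 3)
  qed
  then have "(\<kappa> \<longlongrightarrow> 0) (nhds (\<theta>, 0))" by simp
  moreover have "\<forall>\<^sub>F z in nhds (\<theta>, 0). character (snd z) (fst z) \<longrightarrow>
       norm (ev a (snd z) (fst z) - h (character_point z, snd z)) \<le> \<kappa> z * defect z"
    using ev_at h_at k_at
  proof eventually_elim
    case (elim z)
    show ?case
    proof
      assume "character (snd z) (fst z)"
      with elim have D: "ev a (snd z) (fst z) - h (character_point z, snd z) =
          (\<Sum>i\<in>UNIV. (character_point z $ i - q $ i) * (ev (c i) (snd z) (fst z) - k i (character_point z, snd z)))"
        by (simp add: right_diff_distrib sum_subtractf)
      have E: "ev (c i) (snd z) (fst z) - k i (character_point z, snd z) =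
          (\<Sum>l\<in>UNIV. c i l (snd z) * (fst z $ l - \<phi> l (character_point z))) - (\<Sum>g\<in>G. b i g (character_point z, snd z) * g (character_point z, snd z))" for i
        using elim(3)[rule_format, of i] by (simp add: ev_def right_diff_distrib sum_subtractf algebra_simps)
      have phi_le: "norm (fst z $ l - \<phi> l (character_point z)) \<le> defect z" for l
        unfolding defect_def
        by (intro add_increasing2 sum_nonneg member_le_sum[of l UNIV "\<lambda>l. norm (fst z $ l - \<phi> l (character_point z))"]) auto
      have g_le: "norm (g (character_point z, snd z)) \<le> defect z" if "g \<in> G" for g
        unfolding defect_def using that finite_G
        by (intro add_increasing sum_nonneg member_le_sum[of g G "\<lambda>g. norm (g (character_point z, snd z))"]) auto
      have bound: "norm (ev (c i) (snd z) (fst z) - k i (character_point z, snd z)) \<le>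
          ((\<Sum>l\<in>UNIV. norm (c i l (snd z))) + (\<Sum>g\<in>G. norm (b i g (character_point z, snd z)))) * defect z" for i
      proof -
        have "norm (ev (c i) (snd z) (fst z) - k i (character_point z, snd z)) \<le>
          (\<Sum>l\<in>UNIV. norm (c i l (snd z)) * norm (fst z $ l - \<phi> l (character_point z))) +
          (\<Sum>g\<in>G. norm (b i g (character_point z, snd z)) * norm (g (character_point z, snd z)))"
          unfolding E by (intro order_trans[OF norm_triangle_ineq4] add_mono order_trans[OF norm_sum] sum_mono)
            (simp_all add: norm_mult)
        also have "\<dots> \<le> (\<Sum>l\<in>UNIV. norm (c i l (snd z)) * defect z) + (\<Sum>g\<in>G. norm (b i g (character_point z, snd z)) * defect z)"
          by (intro add_mono sum_mono mult_left_mono phi_le g_le norm_ge_zero)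
        finally show ?thesis by (simp add: distrib_right sum_distrib_right)
      qed
      have "norm (ev a (snd z) (fst z) - h (character_point z, snd z)) \<le>
          (\<Sum>i\<in>UNIV. norm (character_point z $ i - q $ i) * norm (ev (c i) (snd z) (fst z) - k i (character_point z, snd z)))"
        unfolding D by (intro order_trans[OF norm_sum] sum_mono) (simp add: norm_mult)
      also have "\<dots> \<le> (\<Sum>i\<in>UNIV. norm (character_point z $ i - q $ i) *
          (((\<Sum>l\<in>UNIV. norm (c i l (snd z))) + (\<Sum>g\<in>G. norm (b i g (character_point z, snd z)))) * defect z))"
        by (intro sum_mono mult_left_mono bound norm_ge_zero)
      also have "\<dots> = \<kappa> z * defect z" by (simp add: \<kappa>_def sum_distrib_right mult.assoc)
      finally show "norm (ev a (snd z) (fst z) - h (character_point z, snd z)) \<le> \<kappa> z * defect z" .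
    qed
  qed
  ultimately show ?thesis by (rule that)
qed

text \<open>
  The Nakayama step: the defect is a sum of finitely many discrepancies, each at most a small multiple
  of the defect itself.
\<close>
lemma eventually_defect_0:
  assumes ch: "character 0 \<theta>"
  shows "\<forall>\<^sub>F z in nhds (\<theta>, 0). character (snd z) (fst z) \<longrightarrow> defect z = 0"
proof -
  have "\<forall>l. \<exists>\<kappa>. (\<kappa> \<longlongrightarrow> 0) (nhds (\<theta>, 0)) \<and> (\<forall>\<^sub>F z in nhds (\<theta>, 0). character (snd z) (fst z) \<longrightarrow>
       norm (fst z $ l - \<phi> l (character_point z)) \<le> \<kappa> z * defect z)"
  proof
    fix l
    have ev: "ev (\<lambda>l' _. if l' = l then 1 else 0) s \<psi> = \<psi> $ l" for s \<psi>
      by (simp add: ev_def if_distrib[of "\<lambda>c. c * _"] cong: if_cong)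
    obtain \<kappa> where "(\<kappa> \<longlongrightarrow> 0) (nhds (\<theta>, 0))"
      "\<forall>\<^sub>F z in nhds (\<theta>, 0). character (snd z) (fst z) \<longrightarrow>
         norm (ev (\<lambda>l' _. if l' = l then 1 else 0) (snd z) (fst z) - \<phi> l (fst (character_point z, snd z))) \<le> \<kappa> z * defect z"
      by (rule discrepancy_le_defect[OF rep_phi phi_H ch])
    then show "\<exists>\<kappa>. (\<kappa> \<longlongrightarrow> 0) (nhds (\<theta>, 0)) \<and> (\<forall>\<^sub>F z in nhds (\<theta>, 0). character (snd z) (fst z) \<longrightarrow>
       norm (fst z $ l - \<phi> l (character_point z)) \<le> \<kappa> z * defect z)"
      unfolding ev fst_conv by (intro exI conjI)
  qed
  from choice[OF this] obtain \<kappa> where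
    "\<forall>l. (\<kappa> l \<longlongrightarrow> 0) (nhds (\<theta>, 0)) \<and> (\<forall>\<^sub>F z in nhds (\<theta>, 0). character (snd z) (fst z) \<longrightarrow>
       norm (fst z $ l - \<phi> l (character_point z)) \<le> \<kappa> l z * defect z)" ..
  then have \<kappa>: "\<And>l. (\<kappa> l \<longlongrightarrow> 0) (nhds (\<theta>, 0))"
    "\<And>l. \<forall>\<^sub>F z in nhds (\<theta>, 0). character (snd z) (fst z) \<longrightarrow> norm (fst z $ l - \<phi> l (character_point z)) \<le> \<kappa> l z * defect z"
    by simp_all
  have "\<forall>g\<in>G. \<exists>\<kappa>. (\<kappa> \<longlongrightarrow> 0) (nhds (\<theta>, 0)) \<and> (\<forall>\<^sub>F z in nhds (\<theta>, 0). character (snd z) (fst z) \<longrightarrow>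
       norm (g (character_point z, snd z)) \<le> \<kappa> z * defect z)"
  proof
    fix g assume g: "g \<in> G"
    have ev: "ev (\<lambda>_ _. 0) s \<psi> = 0" for s \<psi> by (simp add: ev_def)
    obtain \<kappa> where "(\<kappa> \<longlongrightarrow> 0) (nhds (\<theta>, 0))"
      "\<forall>\<^sub>F z in nhds (\<theta>, 0). character (snd z) (fst z) \<longrightarrow>
         norm (ev (\<lambda>_ _. 0) (snd z) (fst z) - g (character_point z, snd z)) \<le> \<kappa> z * defect z"
      by (rule discrepancy_le_defect[OF rep_J[OF germ_span_generator[OF finite_G g]] G_hol[OF g] ch])
    then show "\<exists>\<kappa>. (\<kappa> \<longlongrightarrow> 0) (nhds (\<theta>, 0)) \<and> (\<forall>\<^sub>F z in nhds (\<theta>, 0). character (snd z) (fst z) \<longrightarrow>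
       norm (g (character_point z, snd z)) \<le> \<kappa> z * defect z)"
      unfolding ev diff_0 norm_minus_cancel by (intro exI conjI)
  qed
  from bchoice[OF this] obtain \<nu> where
    "\<forall>g\<in>G. (\<nu> g \<longlongrightarrow> 0) (nhds (\<theta>, 0)) \<and> (\<forall>\<^sub>F z in nhds (\<theta>, 0). character (snd z) (fst z) \<longrightarrow>
       norm (g (character_point z, snd z)) \<le> \<nu> g z * defect z)" ..
  then have \<nu>: "\<And>g. g \<in> G \<Longrightarrow> (\<nu> g \<longlongrightarrow> 0) (nhds (\<theta>, 0))"
    "\<And>g. g \<in> G \<Longrightarrow> \<forall>\<^sub>F z in nhds (\<theta>, 0). character (snd z) (fst z) \<longrightarrow> norm (g (character_point z, snd z)) \<le> \<nu> g z * defect z"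
    by simp_all
  \<comment> \<open>The total factor by which the defect bounds itself; it tends to 0.\<close>
  define K where "K z = (\<Sum>l\<in>UNIV. \<kappa> l z) + (\<Sum>g\<in>G. \<nu> g z)" for z
  have "(K \<longlongrightarrow> (\<Sum>l\<in>(UNIV :: 'm set). 0) + (\<Sum>g\<in>G. 0)) (nhds (\<theta>, 0))"
    unfolding K_def by (intro tendsto_intros \<kappa> \<nu>)
  then have "\<forall>\<^sub>F z in nhds (\<theta>, 0). K z < 1" by (rule order_tendstoD(2)) simp
  moreover have "\<forall>\<^sub>F z in nhds (\<theta>, 0). \<forall>l. character (snd z) (fst z) \<longrightarrow> norm (fst z $ l - \<phi> l (character_point z)) \<le> \<kappa> l z * defect z"
    by (rule eventually_all_finite[OF \<kappa>(2)])
  moreover have "\<forall>\<^sub>F z in nhds (\<theta>, 0). \<forall>g\<in>G. character (snd z) (fst z) \<longrightarrow> norm (g (character_point z, snd z)) \<le> \<nu> g z * defect z"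
    by (rule eventually_ball_finite[OF finite_G]) (intro ballI \<nu>(2))
  ultimately show ?thesis
  proof eventually_elim
    case (elim z)
    show ?case
    proof
      assume "character (snd z) (fst z)"
      with elim have "defect z \<le> (\<Sum>l\<in>UNIV. \<kappa> l z * defect z) + (\<Sum>g\<in>G. \<nu> g z * defect z)"
        unfolding defect_def[of z] by (intro add_mono sum_mono) (auto simp: defect_def)
      then have "defect z \<le> K z * defect z"
        by (simp only: K_def distrib_right sum_distrib_right)
      moreover have "defect z \<ge> 0" by (simp add: defect_def sum_nonneg)
      ultimately show "defect z = 0"
        using elim(1) mult_strict_right_mono[of "K z" 1 "defect z"] by linarith
    qed
  qed
qed

text \<open>
  If \<open>\<theta>\<close> is not a character of the central fibre, then neither is any nearby vector of a nearby fibre,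
  because characters are described by closed conditions.  To exclude \<open>\<theta> = 0\<close> by a closed condition,
  use that characters map the unit element to 1.
\<close>
lemma eventually_character_is_point_local:
  assumes U: "open U" "cball 0 \<delta> \<subseteq> U"
  shows "\<forall>\<^sub>F z in nhds (\<theta>, 0). character (snd z) (fst z) \<longrightarrow>
    (\<exists>p\<in>U. (\<forall>g\<in>G. g (p, snd z) = 0) \<and> fst z = point_character p)"
proof (cases "character 0 \<theta>")
  case True
  have "\<forall>\<^sub>F z in nhds (\<theta>, 0). character_point z \<in> U"
    using topological_tendstoD[OF tendsto_character_point U(1)] character_point_in_cball[OF True] U(2) by blast
  then show ?thesis using eventually_defect_0[OF True]
  proof eventually_elim
    case (elim z)
    show ?case
    proof
      assume "character (snd z) (fst z)"
      then have "defect z = 0" using elim by simp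
      then have "(\<Sum>l\<in>UNIV. norm (fst z $ l - \<phi> l (character_point z))) = 0 \<and> (\<Sum>g\<in>G. norm (g (character_point z, snd z))) = 0"
        unfolding defect_def by (subst (asm) add_nonneg_eq_0_iff) (auto intro: sum_nonneg)
      then have "fst z = point_character (character_point z)" "\<forall>g\<in>G. g (character_point z, snd z) = 0"
        using finite_G by (auto simp: sum_nonneg_eq_0_iff vec_eq_iff)
      then show "\<exists>p\<in>U. (\<forall>g\<in>G. g (p, snd z) = 0) \<and> fst z = point_character p" using elim(1) by blast
    qed
  qed
next
  case False
  obtain u where u: "rep (\<lambda>_. 1) u" using rep_exists[OF hol_germs_const] by blast
  have "\<forall>\<^sub>F z in nhds (\<theta>, 0). \<not> character (snd z) (fst z)"
  proof (cases "\<theta> = 0")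
    case True
    then have "ev u 0 \<theta> \<noteq> 1" by (simp add: ev_def)
    from tendsto_imp_eventually_ne[OF tendsto_ev[OF u] this] eventually_nhds_snd[OF eventually_ev_one[OF u], of \<theta>]
    show ?thesis by eventually_elim blast
  next
    case nz: False
    with False obtain i j where ij: "\<theta> $ i * \<theta> $ j \<noteq> ev (w i j) 0 \<theta>"
      by (auto simp: algebra_character_def ev_def)
    have "isCont (\<lambda>z. fst z $ i * fst z $ j) (\<theta>, 0 :: complex^'m)" by (intro continuous_intros)
    from isCont_tendsto_nhds[OF this]
    have "((\<lambda>z. fst z $ i * fst z $ j) \<longlongrightarrow> \<theta> $ i * \<theta> $ j) (nhds (\<theta>, 0 :: complex^'m))" by simp
    from tendsto_diff[OF this tendsto_ev[OF rep_phi_mult, of i j]] ij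
    have "\<forall>\<^sub>F z in nhds (\<theta>, 0). fst z $ i * fst z $ j - ev (w i j) (snd z) (fst z) \<noteq> 0"
      by (intro tendsto_imp_eventually_ne) auto
    then show ?thesis by eventually_elim (auto simp: algebra_character_def ev_def)
  qed
  then show ?thesis by eventually_elim simp
qed

text \<open>
  Summing the absolute values of \<open>\<psi>\<^sub>i \<psi>\<^sub>j = \<Sum>\<^sub>l w\<^sub>i\<^sub>j\<^sup>l \<psi>\<^sub>l\<close> over \<open>i\<close> and \<open>j\<close> shows that the square of the
  \<open>l\<^sup>1\<close>-norm of \<open>\<psi>\<close> is at most a constant times the norm.
\<close>
lemma eventually_characters_bounded:
  obtains R where "\<forall>\<^sub>F s in nhds 0. \<forall>\<psi>. character s \<psi> \<longrightarrow> \<psi> \<in> cball 0 R"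
proof -
  define C where "C = (\<Sum>i\<in>UNIV. \<Sum>j\<in>UNIV. \<Sum>l\<in>UNIV. norm (w i j l 0)) + 1"
  have "((\<lambda>s. \<Sum>i\<in>UNIV. \<Sum>j\<in>UNIV. \<Sum>l\<in>UNIV. norm (w i j l s)) \<longlongrightarrow>
      (\<Sum>i\<in>UNIV. \<Sum>j\<in>UNIV. \<Sum>l\<in>UNIV. norm (w i j l 0))) (nhds 0)"
    using hol_germs_isCont[OF w_hol]
    by (intro tendsto_intros) (auto simp: isCont_def tendsto_at_iff_tendsto_nhds)
  then have "\<forall>\<^sub>F s in nhds 0. (\<Sum>i\<in>UNIV. \<Sum>j\<in>UNIV. \<Sum>l\<in>UNIV. norm (w i j l s)) < C"
    by (rule order_tendstoD(2)) (simp add: C_def)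
  then have "\<forall>\<^sub>F s in nhds 0. \<forall>\<psi>. character s \<psi> \<longrightarrow> \<psi> \<in> cball 0 C"
  proof eventually_elim
    case (elim s)
    show ?case
    proof (intro allI impI)
      fix \<psi> assume ch: "character s \<psi>"
      define S where "S = (\<Sum>l\<in>UNIV. norm (\<psi> $ l))"
      have le: "norm (\<psi> $ l) \<le> S" for l
        unfolding S_def by (rule member_le_sum) auto
      have "S * S = (\<Sum>i\<in>UNIV. \<Sum>j\<in>UNIV. norm (\<psi> $ i * \<psi> $ j))"
        by (simp add: S_def sum_product norm_mult)
      also have "\<dots> \<le> (\<Sum>i\<in>UNIV. \<Sum>j\<in>UNIV. \<Sum>l\<in>UNIV. norm (w i j l s) * S)"
      proof (intro sum_mono)
        fix i j
        have "norm (\<psi> $ i * \<psi> $ j) = norm (\<Sum>l\<in>UNIV. w i j l s * \<psi> $ l)"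
          using ch by (simp add: algebra_character_def)
        also have "\<dots> \<le> (\<Sum>l\<in>UNIV. norm (w i j l s) * S)"
          by (intro order_trans[OF norm_sum] sum_mono) (simp add: norm_mult mult_left_mono le)
        finally show "norm (\<psi> $ i * \<psi> $ j) \<le> (\<Sum>l\<in>UNIV. norm (w i j l s) * S)" .
      qed
      also have "\<dots> = (\<Sum>i\<in>UNIV. \<Sum>j\<in>UNIV. \<Sum>l\<in>UNIV. norm (w i j l s)) * S"
        by (simp add: sum_distrib_right)
      also have "\<dots> \<le> C * S"
        using elim by (intro mult_right_mono) (auto simp: S_def intro: sum_nonneg)
      finally have "S * S \<le> C * S" .
      moreover have "0 < C" by (auto simp: C_def intro!: add_nonneg_pos sum_nonneg)
      ultimately have "S \<le> C" by (metis less_le_trans mult_le_cancel_right not_le order_less_imp_le)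
      moreover have "norm \<psi> \<le> S" unfolding S_def norm_vec_def by (rule L2_set_le_sum) simp
      ultimately show "\<psi> \<in> cball 0 C" by simp
    qed
  qed
  then show ?thesis by (rule that)
qed

text \<open>
  The local statement holds near \<open>(\<theta>, 0)\<close> for every \<open>\<theta>\<close>, and characters stay in a compact ball.
\<close>
theorem eventually_character_is_point:
  assumes "open U" "cball 0 \<delta> \<subseteq> U"
  shows "\<forall>\<^sub>F s in nhds 0. \<forall>\<psi>. character s \<psi> \<longrightarrow>
    (\<exists>p\<in>U. (\<forall>g\<in>G. g (p, s) = 0) \<and> \<psi> = point_character p)"
proof -
  obtain R where R: "\<forall>\<^sub>F s in nhds 0. \<forall>\<psi>. character s \<psi> \<longrightarrow> \<psi> \<in> cball 0 R"
    by (rule eventually_characters_bounded)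
  have "\<forall>\<^sub>F s in nhds 0. \<forall>\<psi>\<in>cball 0 R. character s \<psi> \<longrightarrow>
    (\<exists>p\<in>U. (\<forall>g\<in>G. g (p, s) = 0) \<and> \<psi> = point_character p)"
    using eventually_nhds_compact_slice[OF compact_cball eventually_character_is_point_local[OF assms]] by simp
  with R show ?thesis by eventually_elim blast
qed

text \<open>
  Zeros of the equations correspond to characters of the fibre algebra, which are counted by the
  discriminant criterion.
\<close>
theorem eventually_card_fibre:
  assumes U: "open U" "cball 0 \<delta> \<subseteq> U"
    and inside: "\<forall>\<^sub>F s in nhds 0. {p\<in>U. \<forall>g\<in>G. g (p, s) = 0} \<subseteq> cball 0 \<delta>"
  shows "\<forall>\<^sub>F s in nhds 0. finite {p\<in>U. \<forall>g\<in>G. g (p, s) = 0} \<and>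
    card {p\<in>U. \<forall>g\<in>G. g (p, s) = 0} \<le> CARD('m) \<and>
    (card {p\<in>U. \<forall>g\<in>G. g (p, s) = 0} = CARD('m) \<longleftrightarrow> det (trace_form (\<lambda>i j l. w i j l s)) \<noteq> 0)"
  using inside eventually_point_character eventually_point_character_inj
    eventually_character_is_point[OF U] eventually_commutative_algebra
proof eventually_elim
  case (elim s)
  let ?C = "{p\<in>U. \<forall>g\<in>G. g (p, s) = 0}" and ?X = "{\<psi>. character s \<psi>}"
  have C: "?C = {p\<in>cball 0 \<delta>. \<forall>g\<in>G. g (p, s) = 0}" using elim(1) U(2) by blast
  have "bij_betw point_character ?C ?X"
  proof (rule bij_betw_imageI)
    show "inj_on point_character ?C" unfolding C by (rule elim(3))
    show "point_character ` ?C = ?X"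
    proof
      show "point_character ` ?C \<subseteq> ?X" unfolding C using elim(2) by blast
      show "?X \<subseteq> point_character ` ?C" using elim(4) by blast
    qed
  qed
  then have "finite ?C = finite ?X" "card ?C = card ?X"
    by (rule bij_betw_finite, rule bij_betw_same_card)
  moreover from elim(5) obtain u where "commutative_algebra_constants (\<lambda>i j l. w i j l s) u" ..
  then have "card ?X = CARD('m) \<longleftrightarrow> det (trace_form (\<lambda>i j l. w i j l s)) \<noteq> 0"
    using trace_form_nondegenerate_if_split commutative_algebra_constants.split_if_trace_form_nondegenerate by blast
  ultimately show ?case
    using algebra_characters_finite[of "\<lambda>i j l. w i j l s"] by simp
qed

end

section \<open>The bifurcation set\<close>

lemma T_mat_eq_trace_form: "T_mat w t = trace_form (\<lambda>i j l. w i j l t)"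
  by (simp add: T_mat_def trace_form_def W_mat_def zeta_def vec_eq_iff)

lemma t_part_T_space: "t \<in> T_space l0 \<Longrightarrow> t_part l0 t = t"
  by (auto simp: T_space_def t_part_def vec_eq_iff)

text \<open>
  Every parameter of the Maxwell set has exactly \<open>\<mu>\<close> critical points.
\<close>
lemma mem_bifurcation_set_iff:
  "t \<in> bifurcation_set U j1 l0 (F :: _ \<Rightarrow> complex^'m \<Rightarrow> _) \<longleftrightarrow>
     t \<in> T_space l0 \<and> finite (critical_points U j1 F t) \<and> card (critical_points U j1 F t) < CARD('m)"
  by (auto simp: bifurcation_set_def maxwell_set_def)

definition critical_equations ::
  "'k \<Rightarrow> 'm \<Rightarrow> (complex^'n \<Rightarrow> complex^'m \<Rightarrow> complex^'k) \<Rightarrow> ((complex^'n) \<times> (complex^'m) \<Rightarrow> complex) set" where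
  "critical_equations j1 l0 F =
     (\<lambda>j (x, s). F x (t_part l0 s) $ j) ` {j. j \<noteq> j1} \<union>
     (\<lambda>c (x, s). jac_minor c (\<lambda>y. F y (t_part l0 s)) x) ` {c. inj c}"

text \<open>
  The rank condition on the Jacobian matrix is the vanishing of its maximal minors, which are among the
  generators of the ideal \<open>J\<close>.
\<close>
lemma critical_points_eq_zeros:
  fixes F :: "complex^'n \<Rightarrow> complex^'m \<Rightarrow> complex^'k"
  shows "critical_points U j1 F (t_part l0 s) = {x\<in>U. \<forall>g\<in>critical_equations j1 l0 F. g (x, s) = 0}"
proof -
  have "rank (jacobian (\<lambda>y. F y (t_part l0 s)) x) < CARD('k) \<longleftrightarrow>
      (\<forall>c. inj c \<longrightarrow> jac_minor c (\<lambda>y. F y (t_part l0 s)) x = 0)" for x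
    unfolding rank_less_iff_maximal_minors_vanish jac_minor_def by (rule refl)
  then show ?thesis
    by (simp add: critical_points_def critical_equations_def ball_Un)
qed

lemma complex_diff_at_deformation:
  fixes f0 :: "complex^'n \<Rightarrow> complex^'k" and e :: "'m::finite \<Rightarrow> complex^'n \<Rightarrow> complex^'k"
  assumes f0: "complex_diff_at (*s) (\<lambda>y. f0 y $ j) (fst z)"
    and e: "\<And>l. complex_diff_at (*s) (\<lambda>y. e l y $ j) (fst z)"
  shows "complex_diff_at scale_xs (\<lambda>z. deformation l0 f0 e (fst z) (t_part l0 (snd z)) $ j) z"
proof -
  have lift: "complex_diff_at scale_xs (\<lambda>z :: (complex^'n) \<times> (complex^'m). g (fst z)) z"
    if "complex_diff_at (*s) g (fst z)" for g
    using complex_diff_at_affine[of "(*s)" g 0 fst z scale_xs] that bounded_linear_fst by simp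
  have "complex_diff_at scale_xs (\<lambda>z :: (complex^'n) \<times> (complex^'m). snd z $ l) z" for l
    by (rule complex_diff_at_bounded_linear)
      (auto intro: bounded_linear_compose[OF bounded_linear_vec_nth bounded_linear_snd])
  then have "complex_diff_at scale_xs (\<lambda>z. f0 (fst z) $ j + (\<Sum>l\<in>UNIV - {l0}. snd z $ l * e l (fst z) $ j)) z"
    by (intro complex_diff_at_add complex_diff_at_sum complex_diff_at_mult lift[OF f0] lift[OF e])
  moreover have "deformation l0 f0 e (fst z) (t_part l0 (snd z)) $ j =
      f0 (fst z) $ j + (\<Sum>l\<in>UNIV - {l0}. snd z $ l * e l (fst z) $ j)" for z
    by (simp add: deformation_def t_part_def)
  ultimately show ?thesis by simp
qed

lemma complex_diff_at_jac_minor: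
  fixes F :: "complex^'n \<Rightarrow> complex^'m \<Rightarrow> complex^'k"
  assumes "open W" and F: "\<And>j z. z \<in> W \<Longrightarrow> complex_diff_at scale_xs (\<lambda>z. F (fst z) (t_part l0 (snd z)) $ j) z"
    and z: "z \<in> W"
  shows "complex_diff_at scale_xs (\<lambda>z. jac_minor c (\<lambda>y. F y (t_part l0 (snd z))) (fst z)) z"
proof -
  let ?P = "\<lambda>j i. partial_deriv scale_xs (axis (c i) 1, 0) (\<lambda>z. F (fst z) (t_part l0 (snd z)) $ j)"
  have "jac_minor c (\<lambda>y. F y (t_part l0 (snd z))) (fst z) =
      (\<Sum>p\<in>{p. p permutes UNIV}. of_int (sign p) * (\<Prod>j\<in>UNIV. ?P j (p j) z))" for z
    by (simp add: jac_minor_def det_def jacobian_def partial_deriv_def)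
  moreover have "complex_diff_at scale_xs (?P j i) z" for j i
    by (rule xs.complex_diff_at_partial_deriv[OF \<open>open W\<close> _ z]) (rule F)
  then have "complex_diff_at scale_xs
      (\<lambda>z. \<Sum>p\<in>{p. p permutes UNIV}. of_int (sign p) * (\<Prod>j\<in>UNIV. ?P j (p j) z)) z"
    by (intro complex_diff_at_sum complex_diff_at_mult complex_diff_at_const complex_diff_at_prod)
  ultimately show ?thesis by simp
qed

theorem proposition5p3:
  fixes j1 :: "'k::finite" and l0 :: "'m::finite"
    and f0 :: "complex^'n::finite \<Rightarrow> complex^'k"
    and e :: "'m \<Rightarrow> complex^'n \<Rightarrow> complex^'k"
    and F :: "complex^'n \<Rightarrow> complex^'m \<Rightarrow> complex^'k"
    and f :: "(complex^'n) \<times> complex \<Rightarrow> complex^'k"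
    and U :: "(complex^'n) set" and \<delta> :: real
    and \<phi> :: "'m \<Rightarrow> complex^'n \<Rightarrow> complex"
    and w :: "'m \<Rightarrow> 'm \<Rightarrow> 'm \<Rightarrow> complex^'m \<Rightarrow> complex"
  assumes "F = deformation l0 f0 e"
    and "f = (\<lambda>(x,u). F x (axis l0 u))"
    and "0 < \<delta>" and "open U" and "cball 0 \<delta> \<subseteq> U"
    and "\<forall>j. \<forall>x\<in>U. complex_diff_at (*s) (\<lambda>y. f0 y $ j) x"
    and "\<forall>l j. \<forall>x\<in>U. complex_diff_at (*s) (\<lambda>y. e l y $ j) x"
    and "f0 0 = 0"
    and "e l0 = (\<lambda>x. - axis j1 1)"
    and "basis_mod (hol_vec_germs scale_xu {(0,0)}) (Qf_submodule f) (*s) (\<lambda>l (x,u). e l x)"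
    and "\<forall>\<^sub>F s in nhds 0. critical_points U j1 F (t_part l0 s) \<subseteq> cball 0 \<delta>"
    and "basis_mod (hol_germs (*s) (cball 0 \<delta>)) (Phi_ideal j1 \<delta> f0) (*) \<phi>"
    and "free_basis_mod \<delta> (J_ideal j1 l0 \<delta> F) \<phi>"
    and "\<forall>i j l. (\<lambda>s. w i j l (t_part l0 s)) \<in> hol_germs (*s) {0}"
    and "\<forall>i j. (\<lambda>(x,s). \<phi> i x * \<phi> j x - (\<Sum>l\<in>UNIV. w i j l (t_part l0 s) * \<phi> l x))
                 \<in> J_ideal j1 l0 \<delta> F"
  shows "\<exists>N. open N \<and> 0 \<in> N \<and>
           bifurcation_set U j1 l0 F \<inter> N = {t \<in> T_space l0. det (T_mat w t) = 0} \<inter> N"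
proof -
  let ?G = "critical_equations j1 l0 F"
  have J: "J_ideal j1 l0 \<delta> F = germ_span scale_xs (cball 0 \<delta> \<times> {0}) (*) ?G"
    by (simp add: J_ideal_def critical_equations_def setcompr_eq_image)
  have F_diff: "complex_diff_at scale_xs (\<lambda>z. F (fst z) (t_part l0 (snd z)) $ j) z" if "z \<in> U \<times> UNIV" for j z
    unfolding assms(1) using assms(6,7) that by (intro complex_diff_at_deformation) auto
  have "open (U \<times> (UNIV :: (complex^'m) set))" using assms(4) by (simp add: open_Times)
  note minor_diff = complex_diff_at_jac_minor[OF this F_diff]
  interpret family_basis \<delta> ?G \<phi> "\<lambda>i j l s. w i j l (t_part l0 s)"
  proof
    show "finite ?G" by (simp add: critical_equations_def)
    show "g \<in> hol_germs scale_xs (cball 0 \<delta> \<times> {0})" if "g \<in> ?G" for g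
    proof (rule hol_germsI_open[OF \<open>open (U \<times> UNIV)\<close>])
      show "complex_diff_at scale_xs g z" if "z \<in> U \<times> UNIV" for z
        using \<open>g \<in> ?G\<close> F_diff[OF that] minor_diff[OF _ that]
        by (auto simp: critical_equations_def case_prod_unfold)
    qed (use assms(5) in auto)
    show "\<phi> l \<in> hol_germs (*s) (cball 0 \<delta>)" for l using assms(12) by (simp add: basis_mod_def)
  qed (use assms(13-15) J in \<open>auto simp: case_prod_unfold\<close>)
  have "\<forall>\<^sub>F s in nhds 0. {p\<in>U. \<forall>g\<in>?G. g (p, s) = 0} \<subseteq> cball 0 \<delta>"
    using assms(11) by (simp only: critical_points_eq_zeros)
  from eventually_card_fibre[OF assms(4,5) this]
  obtain N where N: "open N" "0 \<in> N" and card: "\<And>s. s \<in> N \<Longrightarrow>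
      finite (critical_points U j1 F (t_part l0 s)) \<and>
      card (critical_points U j1 F (t_part l0 s)) \<le> CARD('m) \<and>
      (card (critical_points U j1 F (t_part l0 s)) = CARD('m) \<longleftrightarrow> det (T_mat w (t_part l0 s)) \<noteq> 0)"
    unfolding eventually_nhds critical_points_eq_zeros T_mat_eq_trace_form by blast
  have key: "t \<in> bifurcation_set U j1 l0 F \<longleftrightarrow> det (T_mat w t) = 0" if "t \<in> N" "t \<in> T_space l0" for t
    using card[OF that(1)] that(2) by (auto simp: mem_bifurcation_set_iff t_part_T_space[OF that(2)])
  have "bifurcation_set U j1 l0 F \<subseteq> T_space l0" by (auto simp: bifurcation_set_def)
  with key have "bifurcation_set U j1 l0 F \<inter> N = {t \<in> T_space l0. det (T_mat w t) = 0} \<inter> N"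
    by blast
  with N show ?thesis by blast
qed

end
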